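(* Let $\rho\ge 0$ be real with $\rho\neq\rho_s$ and $\zeta'(1/2+i\rho)\neq 0$, and suppose $\cos\alpha(\rho)\neq0$ and $\cos\beta(\rho)\neq0$. If $$1+\tan(\alpha(\rho))\,\tan(\beta(\rho))=0,$$ then $\zeta(1/2+i\rho)=0$.
   Context: $\zeta$ is the Riemann zeta function and $\zeta'=d\zeta/ds$ its complex derivative. $\beta(\rho)=\arg\zeta'(1/2+i\rho)$. The continuous function $\alpha(\rho)$ is the imaginary part of the paper's LogZeta function on the critical line: $$\alpha(\rho)=-\frac12\,\mathrm{Im}\,\mathrm{Log}\Gamma(1/2+i\rho)+\frac{\rho}{2}\ln(2\pi)-\frac{9\pi}{8}+\frac12\arctan(e^{\pi\rho}),$$ where $\mathrm{Log}\Gamma$ is the LogGamma function, i.e. the analytic branch of $\log\Gamma$ on the right half-plane that is real on the positive real axis. With $\psi=\Gamma'/\Gamma$ the digamma function, $\rho_s=6.2898\ldots$ is the unique $\rho>0$ such that $$2\ln(2\pi)\cosh(\pi\rho)-2\,\mathrm{Re}(\psi(1/2+i\rho))\cosh(\pi\rho)+\pi=0.$$ *)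

theory Defs
  imports "HOL-Complex_Analysis.Complex_Analysis"
begin

text \<open>
  The Riemann zeta function as the analytic continuation of its Dirichlet series to the complex
  plane without the pole at 1; the value 0 at the pole is a convention that makes the function
  unique as a total function.
\<close>

definition zeta :: "complex \<Rightarrow> complex" where
  "zeta = (THE f. f holomorphic_on (- {1}) \<and> f 1 = 0 \<and>
     (\<forall>s. Re s > 1 \<longrightarrow> (\<lambda>n. 1 / of_nat (Suc n) powr s) sums f s))"

definition critical_point :: "real \<Rightarrow> complex" where
  "critical_point \<rho> = 1 / 2 + \<i> * of_real \<rho>"

text \<open>
  The library function \<open>ln_Gamma\<close> on the complex numbers is holomorphic off the non-positive
  real axis and real on the positive one, so it is the required LogGamma branch; it is not
  \<open>Ln (Gamma z)\<close>.
\<close>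

definition alpha :: "real \<Rightarrow> real" where
  "alpha \<rho> = - (1 / 2) * Im (ln_Gamma (critical_point \<rho>)) + \<rho> / 2 * ln (2 * pi)
     - 9 * pi / 8 + 1 / 2 * arctan (exp (pi * \<rho>))"

definition beta :: "real \<Rightarrow> real" where
  "beta \<rho> = Arg (deriv zeta (critical_point \<rho>))"

definition rho_s :: real where
  "rho_s = (THE \<rho>. \<rho> > 0 \<and>
     2 * ln (2 * pi) * cosh (pi * \<rho>)
       - 2 * Re (Digamma (critical_point \<rho>)) * cosh (pi * \<rho>) + pi = 0)"

end

theory Submission
  imports Defs
begin

text \<open>
  On the critical line the functional equation \<open>zeta (1 - s) = K s * zeta s\<close> with
  \<open>K s = 2 (2 pi) powr (- s) cos (pi s / 2) Gamma s\<close> reads \<open>cnj (zeta s) = exp (- 2 i alpha) zeta s\<close>.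
  Differentiating it gives \<open>- 2 Re (exp (- i alpha) zeta' s) = exp (i alpha) K' s zeta s\<close>, and the
  hypothesis says \<open>cos (beta - alpha) = 0\<close>, i.e. the left-hand side vanishes. So either \<open>zeta s = 0\<close>
  or \<open>K' s = 0\<close>; the real part of \<open>K' s / K s\<close> is, up to a positive factor, the negative of the function
  defining \<open>rho_s\<close>, whose quotient by \<open>cosh (pi \<rho>)\<close> is strictly decreasing for \<open>\<rho> \<ge> 0\<close>.

  The continuation and the functional equation of zeta come from its Mellin transform: for
  \<open>-1 < s < 0\<close>, \<open>Gamma s * zeta s\<close> is the integral of
  \<open>(1 / (exp x - 1) - 1 / x + 1 / 2) x powr (s - 1)\<close> over the positive reals, and integrating the partial
  fraction expansion \<open>\<Sum>n\<ge>1. 2 x / (x\<^sup>2 + (2 pi n)\<^sup>2)\<close> of the first factor termwise produces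
  the Dirichlet series of \<open>zeta (1 - s)\<close>.
\<close>

subsection \<open>Mellin transforms\<close>

text \<open>The substitution of a * x for x in Euler's integral. With a = n + 1 it yields the terms
  of the Dirichlet series.\<close>

lemma Gamma_integral_scaled:
  fixes s :: complex and a :: real
  assumes s: "Re s > 0" and a: "a > 0"
  shows "set_integrable lborel {0<..} (\<lambda>x. of_real x powr (s - 1) * of_real (exp (- a * x)))"
    and "(LBINT x:{0<..}. of_real x powr (s - 1) * of_real (exp (- a * x))) = Gamma s * of_real a powr (- s)"
proof -
  define f where "f = (\<lambda>x::real. indicator {0<..} x *\<^sub>R (of_real x powr (s - 1) * complex_of_real (exp (- x))))"
  have fm: "f \<in> borel_measurable borel"
    unfolding f_def by measurable
  have eq: "of_real t powr (s - 1) / of_real (exp t) = of_real t powr (s - 1) * complex_of_real (exp (- t))" for t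
    by (simp add: exp_minus field_simps)
  \<comment> \<open>Euler's integral comes for the completed measure and as a gauge integral. Borel
    measurability of \<open>f\<close> brings integrability to \<open>lborel\<close>; uniqueness of
    the gauge integral then identifies the value.\<close>
  have "integrable lebesgue f"
    using absolutely_integrable_Gamma_integral'[OF s]
    unfolding f_def set_integrable_def eq .
  hence int: "integrable lborel f"
    using fm by (simp add: integrable_completion)
  have "((\<lambda>x. of_real x powr (s - 1) * complex_of_real (exp (- x))) has_integral (integral\<^sup>L lborel f)) {0<..}"
    using has_integral_integral_lborel[OF int]
    unfolding f_def indicator_def
    by (subst has_integral_restrict_UNIV [symmetric]) (auto elim!: has_integral_eq[rotated])
  moreover have "((\<lambda>x. of_real x powr (s - 1) * complex_of_real (exp (- x))) has_integral Gamma s) {0<..}"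
    using Gamma_integral_complex'[OF s] unfolding eq .
  ultimately have val: "integral\<^sup>L lborel f = Gamma s"
    by (rule has_integral_unique)
  have feq: "f (a * x) = of_real a powr (s - 1) *
        (indicator {0<..} x *\<^sub>R (of_real x powr (s - 1) * of_real (exp (- a * x))))" for x
  proof (cases "x > 0")
    case True
    with a show ?thesis
      by (simp add: f_def powr_times_real indicator_def)
  next
    case False
    with a show ?thesis by (simp add: f_def indicator_def zero_less_mult_iff)
  qed
  have a0: "of_real a powr (s - 1) \<noteq> (0::complex)" using a by simp
  have "integrable lborel (\<lambda>x. f (0 + a * x))"
    by (rule lborel_integrable_real_affine[OF int]) (use a in auto)
  hence i: "integrable lborel (\<lambda>x. of_real a powr (s - 1) *
        (indicator {0<..} x *\<^sub>R (of_real x powr (s - 1) * complex_of_real (exp (- a * x)))))"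
    by (simp add: feq)
  thus *: "set_integrable lborel {0<..} (\<lambda>x. of_real x powr (s - 1) * complex_of_real (exp (- a * x)))"
    using integrable_mult_right[OF i, of "inverse (of_real a powr (s - 1))"] a0
    unfolding set_integrable_def by (simp add: mult.assoc[symmetric] del: mult_scaleR_right)
  have "Gamma s = \<bar>a\<bar> *\<^sub>R (\<integral>x. f (0 + a * x) \<partial>lborel)"
    using lborel_integral_real_affine[of a f 0] a val by simp
  also have "\<dots> = of_real a powr s * (LBINT x:{0<..}. of_real x powr (s - 1) * of_real (exp (- a * x)))"
    unfolding add_0 feq integral_mult_right_zero set_lebesgue_integral_def
    using a by (simp add: scaleR_conv_of_real powr_diff)
  finally show "(LBINT x:{0<..}. of_real x powr (s - 1) * of_real (exp (- a * x))) = Gamma s * of_real a powr (- s)"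
    using a by (simp add: powr_minus field_simps)
qed

text \<open>Expanding \<open>x powr (s - s0)\<close> as an exponential series in \<open>s - s0\<close> and integrating
  termwise turns the transform into a power series around \<open>s0\<close>.\<close>

lemma Mellin_holomorphic:
  fixes h :: "real \<Rightarrow> real" and a :: real
  assumes h: "h \<in> borel_measurable borel"
    and int: "\<And>\<sigma>. \<sigma> > a \<Longrightarrow> set_integrable lborel {0<..} (\<lambda>x. h x * x powr (\<sigma> - 1))"
  shows "(\<lambda>s. LBINT x:{0<..}. of_real (h x) * of_real x powr (s - 1)) holomorphic_on {s. Re s > a}"
proof -
  define M where "M = (\<lambda>s. LBINT x:{0<..}. complex_of_real (h x) * of_real x powr (s - 1))"
  have "M holomorphic_on ball s0 (Re s0 - a)" if s0: "Re s0 > a" for s0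
  proof (rule power_series_holomorphic)
    fix w assume w: "w \<in> ball s0 (Re s0 - a)"
    define r where "r = norm (w - s0)"
    have r: "r < Re s0 - a" "r \<ge> 0" using w by (auto simp: r_def dist_norm norm_minus_commute)
    define T where "T = (\<lambda>n x. indicator {0<..} x *\<^sub>R
       (complex_of_real (h x) * of_real x powr (s0 - 1) * (of_real (ln x ^ n / fact n) * (w - s0) ^ n)))"
    have Tm: "T n \<in> borel_measurable lborel" for n
      unfolding T_def using h by measurable
    have Tn: "norm (T n x) = indicator {0<..} x * \<bar>h x\<bar> * x powr (Re s0 - 1) * ((r * \<bar>ln x\<bar>) ^ n / fact n)" for n x
      by (auto simp: T_def indicator_def norm_mult norm_divide norm_powr_real_powr norm_power r_def power_mult_distrib
            power_abs field_simps)
    have exps: "(\<lambda>n. (r * \<bar>ln x\<bar>) ^ n / fact n) sums exp (r * \<bar>ln x\<bar>)" for x :: real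
      using exp_converges[of "r * \<bar>ln x\<bar>"] by (simp add: divide_inverse mult.commute)
    define G where "G = (\<lambda>x. indicator {0<..} x * \<bar>h x\<bar> * x powr (Re s0 - 1) * exp (r * \<bar>ln x\<bar>))"
    have Gs: "(\<lambda>n. norm (T n x)) sums G x" for x
      unfolding Tn G_def by (intro sums_mult exps)
    have Gm: "G \<in> borel_measurable lborel"
      unfolding G_def using h by measurable
    have Gint: "integrable lborel G"
    \<comment> \<open>Since \<open>exp (r * \<bar>ln x\<bar>)\<close> is at most
      \<open>x powr r + x powr (- r)\<close>, the series of norms is controlled by the integrands at
      Re s0 + r and Re s0 - r. Both exponents exceed \<open>a\<close> because r < Re s0 - a.\<close>
    proof (rule Bochner_Integration.integrable_bound)
      show "integrable lborel (\<lambda>x. norm (indicator {0<..} x *\<^sub>R (h x * x powr (Re s0 + r - 1))) +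
                norm (indicator {0<..} x *\<^sub>R (h x * x powr (Re s0 - r - 1))))"
        using int[of "Re s0 + r"] int[of "Re s0 - r"] r s0 unfolding set_integrable_def
        by (intro Bochner_Integration.integrable_add integrable_norm) auto
      show "AE x in lborel. norm (G x) \<le> norm (norm (indicator {0<..} x *\<^sub>R (h x * x powr (Re s0 + r - 1))) +
                norm (indicator {0<..} x *\<^sub>R (h x * x powr (Re s0 - r - 1))))"
      proof (intro AE_I2)
        fix x :: real
        show "norm (G x) \<le> norm (norm (indicator {0<..} x *\<^sub>R (h x * x powr (Re s0 + r - 1))) +
                norm (indicator {0<..} x *\<^sub>R (h x * x powr (Re s0 - r - 1))))"
        proof (cases "x > 0")
          case x: True
          have "exp (r * \<bar>ln x\<bar>) \<le> x powr r + x powr (- r)"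
            using x by (cases "ln x \<ge> 0") (auto simp: powr_def)
          hence "x powr (Re s0 - 1) * exp (r * \<bar>ln x\<bar>) \<le> x powr (Re s0 - 1) * (x powr r + x powr (- r))"
            by (intro mult_left_mono) auto
          also have "\<dots> = x powr (Re s0 + r - 1) + x powr (Re s0 - r - 1)"
            by (simp add: distrib_left powr_add[symmetric] algebra_simps)
          finally have "\<bar>h x\<bar> * (x powr (Re s0 - 1) * exp (r * \<bar>ln x\<bar>)) \<le>
             \<bar>h x\<bar> * (x powr (Re s0 + r - 1) + x powr (Re s0 - r - 1))"
            by (intro mult_left_mono) auto
          thus ?thesis using x by (simp add: G_def indicator_def abs_mult algebra_simps)
        qed (auto simp: G_def)
      qed
    qed (rule Gm)
    have Tint: "integrable lborel (T n)" for n
    proof (rule Bochner_Integration.integrable_bound[OF Gint Tm], intro AE_I2)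
      fix x
      have "norm (T n x) \<le> G x"
        using sum_le_suminf[OF sums_summable[OF Gs[of x]], of "{n}"] sums_unique[OF Gs[of x]] by simp
      thus "norm (T n x) \<le> norm (G x)" by simp
    qed
    have Tsum: "summable (\<lambda>n. \<integral>x. norm (T n x) \<partial>lborel)"
    proof (rule bounded_imp_summable)
      fix N
      have "(\<Sum>n\<le>N. \<integral>x. norm (T n x) \<partial>lborel) = (\<integral>x. (\<Sum>n\<le>N. norm (T n x)) \<partial>lborel)"
        using Tint by (subst Bochner_Integration.integral_sum) auto
      also have "\<dots> \<le> integral\<^sup>L lborel G"
      proof (rule integral_mono[OF _ Gint])
        fix x
        show "(\<Sum>n\<le>N. norm (T n x)) \<le> G x"
          using sum_le_suminf[OF sums_summable[OF Gs[of x]], of "{..N}"] sums_unique[OF Gs[of x]] by simp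
      qed (use Tint in auto)
      finally show "(\<Sum>n\<le>N. \<integral>x. norm (T n x) \<partial>lborel) \<le> integral\<^sup>L lborel G" .
    qed auto
    have Tsuminf: "(\<Sum>n. T n x) = indicator {0<..} x *\<^sub>R (complex_of_real (h x) * of_real x powr (w - 1))" for x
    proof (cases "x > 0")
      case x: True
      have "(\<lambda>n. ((w - s0) * of_real (ln x)) ^ n /\<^sub>R fact n) sums exp ((w - s0) * of_real (ln x))"
        by (rule exp_converges)
      also have "exp ((w - s0) * of_real (ln x)) = of_real x powr (w - s0)"
        using x by (simp add: powr_def Ln_of_real)
      finally have "(\<lambda>n. complex_of_real (h x) * of_real x powr (s0 - 1) *
           (((w - s0) * of_real (ln x)) ^ n /\<^sub>R fact n)) sums
         (complex_of_real (h x) * of_real x powr (s0 - 1) * of_real x powr (w - s0))"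
        by (rule sums_mult)
      also have "complex_of_real (h x) * of_real x powr (s0 - 1) * of_real x powr (w - s0) =
          of_real (h x) * of_real x powr (w - 1)"
        using x by (simp add: powr_add[symmetric] mult.assoc)
      finally have "(\<lambda>n. T n x) sums (of_real (h x) * of_real x powr (w - 1))"
        using x by (simp add: T_def indicator_def scaleR_conv_of_real power_mult_distrib divide_inverse mult_ac
            del: left_diff_distrib right_diff_distrib)
      thus ?thesis using x by (simp add: sums_iff)
    qed (auto simp: T_def)
    have "(\<lambda>n. integral\<^sup>L lborel (T n)) sums (\<integral>x. (\<Sum>n. T n x) \<partial>lborel)"
      using Tint Tsum sums_summable[OF Gs] by (intro sums_integral) auto
    also have "(\<integral>x. (\<Sum>n. T n x) \<partial>lborel) = M w"
      by (simp add: Tsuminf M_def set_lebesgue_integral_def)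
    also have "(\<lambda>n. integral\<^sup>L lborel (T n)) = (\<lambda>n. (LBINT x:{0<..}. complex_of_real (h x) * of_real x powr (s0 - 1) * of_real (ln x ^ n / fact n)) * (w - s0) ^ n)"
      unfolding set_lebesgue_integral_def T_def
      by (subst integral_mult_left_zero[symmetric]) (simp add: mult_ac scaleR_conv_of_real)
    finally show "(\<lambda>n. (LBINT x:{0<..}. complex_of_real (h x) * of_real x powr (s0 - 1) * of_real (ln x ^ n / fact n)) * (w - s0) ^ n) sums M w" .
  qed
  hence "M analytic_on {s. Re s > a}"
    unfolding analytic_on_def by (metis diff_gt_0_iff_gt mem_Collect_eq)
  thus ?thesis unfolding M_def by (rule analytic_imp_holomorphic)
qed

subsection \<open>Partial fractions of the Bose kernel\<close>

text \<open>Logarithmic differentiation of the reflection formula for Gamma.\<close>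

lemma Digamma_reflection_complex:
  fixes z :: complex
  assumes z: "z \<notin> \<int>"
  shows "Digamma (1 - z) - Digamma z = of_real pi * cos (of_real pi * z) / sin (of_real pi * z)"
proof -
  have s0: "sin (of_real pi * z) \<noteq> 0"
    using z by (auto simp: sin_eq_0 mult_ac)
  have z1: "z \<notin> \<int>\<^sub>\<le>\<^sub>0" and z2: "1 - z \<notin> \<int>\<^sub>\<le>\<^sub>0"
    using z by (auto dest!: nonpos_Ints_Int)
  have "((\<lambda>z. Gamma z * Gamma (1 - z)) has_field_derivative
          Gamma z * Gamma (1 - z) * (Digamma z - Digamma (1 - z))) (at z)"
    using z1 z2 by (auto intro!: derivative_eq_intros simp: algebra_simps)
  moreover have "((\<lambda>z. of_real pi / sin (of_real pi * z)) has_field_derivative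
          of_real pi / sin (of_real pi * z) * (- of_real pi * cos (of_real pi * z) / sin (of_real pi * z))) (at z)"
    using s0 by (auto intro!: derivative_eq_intros simp: field_simps power2_eq_square)
  ultimately have "Gamma z * Gamma (1 - z) * (Digamma z - Digamma (1 - z)) =
      of_real pi / sin (of_real pi * z) * (- of_real pi * cos (of_real pi * z) / sin (of_real pi * z))"
    unfolding Gamma_reflection_complex by (rule DERIV_unique)
  hence "Digamma z - Digamma (1 - z) = - of_real pi * cos (of_real pi * z) / sin (of_real pi * z)"
    unfolding Gamma_reflection_complex using s0 by (subst (asm) mult_left_cancel) auto
  thus ?thesis by (simp add: algebra_simps)
qed

text \<open>Subtract the digamma series at 1 + z from the one at 1 - z, where z = i y. Recurrence
  and reflection turn the sum into pi cot (pi z) - 1 / z, and at an imaginary argument the cotangent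
  becomes hyperbolic.\<close>

lemma coth_partial_fractions:
  fixes y :: real
  assumes y: "y > 0"
  shows "(\<lambda>n. 2 * y / ((real n + 1)\<^sup>2 + y\<^sup>2)) sums (pi * cosh (pi * y) / sinh (pi * y) - 1 / y)"
proof -
  define z where "z = \<i> * complex_of_real y"
  have z: "z \<noteq> 0" "1 + z \<noteq> 0" "1 - z \<noteq> 0" using y by (auto simp: z_def complex_eq_iff)
  have zI: "z \<notin> \<int>" using y by (auto simp: z_def complex_eq_iff elim!: Ints_cases)
  have "(\<lambda>n. (inverse (of_nat (Suc n)) - inverse (1 - z + of_nat n)) -
             (inverse (of_nat (Suc n)) - inverse (1 + z + of_nat n))) sums
        ((Digamma (1 - z) + euler_mascheroni) - (Digamma (1 + z) + euler_mascheroni))"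
    using summable_sums[OF summable_Digamma[OF z(3)]] summable_sums[OF summable_Digamma[OF z(2)]]
    by (intro sums_diff) (simp_all add: Digamma_def)
  also have "(Digamma (1 - z) + euler_mascheroni) - (Digamma (1 + z) + euler_mascheroni) =
               Digamma (1 - z) - Digamma z - 1 / z"
    using Digamma_plus1[OF z(1)] by (simp add: add.commute)
  also have "\<dots> = of_real pi * cos (of_real pi * z) / sin (of_real pi * z) - 1 / z"
    by (simp add: Digamma_reflection_complex[OF zI])
  also have "cos (of_real pi * z) = of_real (cosh (pi * y))"
    by (simp add: z_def cosh_field_def cos_exp_eq exp_of_real[symmetric] mult_ac flip: of_real_mult)
  also have "sin (of_real pi * z) = \<i> * of_real (sinh (pi * y))"
    by (simp add: z_def sinh_field_def sin_exp_eq exp_of_real[symmetric] field_simps flip: of_real_mult)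
  \<comment> \<open>The factor i makes terms and sum real, so that the identity descends to the
    reals.\<close>
  finally have "(\<lambda>n. \<i> * ((inverse (of_nat (Suc n)) - inverse (1 - z + of_nat n)) -
             (inverse (of_nat (Suc n)) - inverse (1 + z + of_nat n)))) sums
        (\<i> * (of_real pi * of_real (cosh (pi * y)) / (\<i> * of_real (sinh (pi * y))) - 1 / z))"
    by (rule sums_mult)
  also have "\<i> * (of_real pi * of_real (cosh (pi * y)) / (\<i> * of_real (sinh (pi * y))) - 1 / z) =
      of_real (pi * cosh (pi * y) / sinh (pi * y) - 1 / y)"
    using y by (simp add: z_def field_simps)
  also have "(\<lambda>n. \<i> * ((inverse (of_nat (Suc n)) - inverse (1 - z + of_nat n)) -
             (inverse (of_nat (Suc n)) - inverse (1 + z + of_nat n)))) =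
      (\<lambda>n. complex_of_real (2 * y / ((real n + 1)\<^sup>2 + y\<^sup>2)))"
  proof
    fix n
    have cancel: "(a - b) - (a - c) = c - b" for a b c :: complex by simp
    have nz: "1 - z + of_nat n \<noteq> 0" "1 + z + of_nat n \<noteq> 0"
      using y by (auto simp: z_def complex_eq_iff)
    have A: "(1 - z + of_nat n) * (1 + z + of_nat n) = of_real ((real n + 1)\<^sup>2 + y\<^sup>2)"
      by (simp add: z_def power2_eq_square algebra_simps)
    have B: "\<i> * ((inverse (of_nat (Suc n)) - inverse (1 - z + of_nat n)) -
             (inverse (of_nat (Suc n)) - inverse (1 + z + of_nat n))) =
          - 2 * \<i> * z / ((1 - z + of_nat n) * (1 + z + of_nat n))"
      unfolding cancel using nz by (simp add: field_simps)
    have C: "- 2 * \<i> * z = of_real (2 * y)" by (simp add: z_def)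
    show "\<i> * ((inverse (of_nat (Suc n)) - inverse (1 - z + of_nat n)) -
             (inverse (of_nat (Suc n)) - inverse (1 + z + of_nat n))) =
          complex_of_real (2 * y / ((real n + 1)\<^sup>2 + y\<^sup>2))"
      unfolding B A C by (simp only: of_real_divide)
  qed
  finally show ?thesis by (simp only: sums_of_real_iff)
qed

text \<open>For small x > 0 this is the sum over n \<ge> 2 of B_n x^(n-1) / n! with the Bernoulli
  numbers B_n; for all x > 0 it equals coth (x / 2) / 2 - 1 / x.\<close>

definition bernoulli_tail :: "real \<Rightarrow> real" where
  "bernoulli_tail x = 1 / (exp x - 1) - 1 / x + 1 / 2"

text \<open>The expansion of coth at y = x / (2 pi), rescaled.\<close>

lemma bernoulli_tail_sums:
  assumes x: "x > 0"
  shows "(\<lambda>n. 2 * x / (x\<^sup>2 + (2 * pi * (real n + 1))\<^sup>2)) sums bernoulli_tail x"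
proof -
  define y where "y = x / (2 * pi)"
  have y: "y > 0" "x = 2 * pi * y" using x by (simp_all add: y_def)
  have "(\<lambda>n. 1 / (2 * pi) * (2 * y / ((real n + 1)\<^sup>2 + y\<^sup>2))) sums
     (1 / (2 * pi) * (pi * cosh (pi * y) / sinh (pi * y) - 1 / y))"
    by (intro sums_mult coth_partial_fractions y)
  also have "1 / (2 * pi) * (pi * cosh (pi * y) / sinh (pi * y) - 1 / y) = bernoulli_tail x"
  proof -
    define e where "e = exp (pi * y)"
    have e: "e > 1" using y by (simp add: e_def)
    have ex: "exp x = e * e" by (simp add: e_def y(2) flip: exp_add)
    have "e * e > 1" using e by (metis less_1_mult)
    have half_cancel: "(a / 2) / (b / 2) = a / b" for a b :: real by simp
    have "cosh (pi * y) / sinh (pi * y) = ((e + 1 / e) / 2) / ((e - 1 / e) / 2)"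
      by (simp add: cosh_field_def sinh_field_def e_def exp_minus inverse_eq_divide)
    also have "\<dots> = (e + 1 / e) / (e - 1 / e)"
      by (rule half_cancel)
    also have "\<dots> = (e * e + 1) / (e * e - 1)"
      using e \<open>e * e > 1\<close> by (simp add: field_simps)
    also have "\<dots> = 1 + 2 / (e * e - 1)"
      using \<open>e * e > 1\<close> by (simp add: field_simps)
    finally have c: "cosh (pi * y) / sinh (pi * y) = 1 + 2 / (e * e - 1)" .
    have "1 / (2 * pi) * (pi * cosh (pi * y) / sinh (pi * y) - 1 / y) =
        cosh (pi * y) / sinh (pi * y) / 2 - 1 / (2 * pi * y)"
      using y by (simp add: field_simps)
    thus ?thesis unfolding c bernoulli_tail_def ex y(2)[symmetric] by (simp add: field_simps)
  qed
  also have "(\<lambda>n. 1 / (2 * pi) * (2 * y / ((real n + 1)\<^sup>2 + y\<^sup>2))) =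
     (\<lambda>n. 2 * x / (x\<^sup>2 + (2 * pi * (real n + 1))\<^sup>2))"
  proof
    fix n
    have "x\<^sup>2 + (2 * pi * (real n + 1))\<^sup>2 = 4 * pi\<^sup>2 * ((real n + 1)\<^sup>2 + y\<^sup>2)"
      by (simp add: y(2) power2_eq_square algebra_simps)
    thus "1 / (2 * pi) * (2 * y / ((real n + 1)\<^sup>2 + y\<^sup>2)) =
       2 * x / (x\<^sup>2 + (2 * pi * (real n + 1))\<^sup>2)"
      by (simp add: y(2) power2_eq_square)
  qed
  finally show ?thesis .
qed

lemma bernoulli_tail_nonneg:
  assumes "x > 0"
  shows "bernoulli_tail x \<ge> 0"
  using assms by (intro sums_le[OF _ sums_zero bernoulli_tail_sums]) auto

text \<open>Dropping x^2 from the denominators leaves a multiple of the Basel series, and 1 / (2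
  pi^2) times pi^2 / 6 is 1 / 12.\<close>

lemma bernoulli_tail_le:
  assumes x: "x > 0"
  shows "bernoulli_tail x \<le> x / 12"
proof (rule sums_le[OF _ bernoulli_tail_sums[OF x]])
  have "(\<lambda>n. x / (2 * pi\<^sup>2) * (1 / (real n + 1)\<^sup>2)) sums (x / (2 * pi\<^sup>2) * (pi\<^sup>2 / 6))"
    using inverse_squares_sums by (intro sums_mult) (simp add: add_ac)
  thus "(\<lambda>n. x / (2 * pi\<^sup>2) * (1 / (real n + 1)\<^sup>2)) sums (x / 12)" by simp
  fix n
  have "2 * x / (x\<^sup>2 + (2 * pi * (real n + 1))\<^sup>2) \<le> 2 * x / ((2 * pi * (real n + 1))\<^sup>2)"
    using x by (intro divide_left_mono mult_pos_pos add_nonneg_pos) auto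
  thus "2 * x / (x\<^sup>2 + (2 * pi * (real n + 1))\<^sup>2) \<le> x / (2 * pi\<^sup>2) * (1 / (real n + 1)\<^sup>2)"
    by (simp add: power_mult_distrib)
qed

text \<open>Removing the principal part only near 0 keeps the exponential decay at infinity, so that the
  Mellin transform converges for \<open>Re s > -1\<close>.\<close>

definition zeta_kernel :: "real \<Rightarrow> real" where
  "zeta_kernel x = 1 / (exp x - 1) - (if x \<le> 1 then 1 / x - 1 / 2 else 0)"

text \<open>One majorant for both ends: the factor x allows exponents down to -1 at 0, the
  exponential gives convergence at infinity. The constant 2 comes from x > 1, where exp x \<ge>
  2.\<close>

lemma zeta_kernel_bound:
  assumes x: "x > 0"
  shows "\<bar>zeta_kernel x\<bar> \<le> 2 * x * exp (- x)"
proof (cases "x \<le> 1")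
  case True
  have k: "zeta_kernel x = bernoulli_tail x" using True by (simp add: zeta_kernel_def bernoulli_tail_def)
  \<comment> \<open>The comparison of x / 12 with 2 x exp (- x) amounts to 1 / 24 \<le> exp (- x),
    which is tightest at x = 1.\<close>
  have "(1 / 24 :: real) \<le> exp (- 1)"
    using e_less_272 by (simp add: exp_minus field_simps)
  also have "exp (- 1) \<le> exp (- x)" using True by simp
  finally have "x / 12 \<le> 2 * x * exp (- x)" using x by simp
  with bernoulli_tail_le[OF x] have "bernoulli_tail x \<le> 2 * x * exp (- x)" by (rule order_trans)
  thus ?thesis using bernoulli_tail_nonneg[OF x] by (simp add: k)
next
  case False
  have "exp x \<ge> 2" using exp_ge_add_one_self[of x] False by linarith
  hence "1 / (exp x - 1) \<le> 2 / exp x" using False by (simp add: divide_simps)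
  also have "2 / exp x = 2 * exp (- x)" by (simp add: exp_minus divide_inverse)
  also have "2 * exp (- x) \<le> 2 * x * exp (- x)" using False by simp
  finally show ?thesis using False \<open>exp x \<ge> 2\<close> by (simp add: zeta_kernel_def)
qed

subsection \<open>Gamma and beta integrals\<close>

lemma Gamma_integral_scaled_real:
  fixes s a :: real
  assumes s: "s > 0" and a: "a > 0"
  shows "set_integrable lborel {0<..} (\<lambda>x. x powr (s - 1) * exp (- a * x))"
    and "(LBINT x:{0<..}. x powr (s - 1) * exp (- a * x)) = Gamma s * a powr (- s)"
proof -
  have eq: "of_real x powr (of_real s - 1) * complex_of_real (exp (- a * x)) =
            of_real (x powr (s - 1) * exp (- a * x))" if "x \<in> {0<..}" for x
    using that powr_of_real[of x "s - 1"] by simp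
  have "set_integrable lborel {0<..} (\<lambda>x. complex_of_real (x powr (s - 1) * exp (- a * x)))"
    using Gamma_integral_scaled(1)[of "of_real s" a] s a eq
    by (subst (asm) set_integrable_cong[OF refl refl eq]) auto
  from set_integrable_norm[OF this]
  show "set_integrable lborel {0<..} (\<lambda>x. x powr (s - 1) * exp (- a * x))"
    by (simp add: norm_mult)
  have "complex_of_real (LBINT x:{0<..}. x powr (s - 1) * exp (- a * x)) =
        (LBINT x:{0<..}. of_real x powr (of_real s - 1) * complex_of_real (exp (- a * x)))"
    unfolding set_integral_complex_of_real[symmetric]
    by (rule set_lebesgue_integral_cong, simp, intro allI impI, rule eq[symmetric])
  also have "\<dots> = of_real (Gamma s * a powr (- s))"
    using Gamma_integral_scaled(2)[of "of_real s" a] s a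
      powr_of_real[of a "- s"]
    by (simp add: Gamma_complex_of_real)
  finally show "(LBINT x:{0<..}. x powr (s - 1) * exp (- a * x)) = Gamma s * a powr (- s)"
    by (simp only: of_real_eq_iff)
qed

lemma nn_integral_Gamma_scaled:
  fixes s a :: real
  assumes s: "s > 0" and a: "a > 0"
  shows "(\<integral>\<^sup>+x. ennreal (indicator {0<..} x * (x powr (s - 1) * exp (- a * x))) \<partial>lborel) = ennreal (Gamma s * a powr (- s))"
  using Gamma_integral_scaled_real[OF s a] unfolding set_integrable_def set_lebesgue_integral_def
  by (subst nn_integral_eq_integral) auto

text \<open>Write 1 / (1 + t) as the integral of exp (- (1 + t) x) over x > 0 and exchange the order
  of integration, which is free for nonnegative integrands. The result is Gamma a * Gamma (1 - a),
  evaluated by reflection.\<close>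

lemma nn_integral_Gamma_reflection:
  fixes a :: real
  assumes a: "0 < a" "a < 1"
  shows "(\<integral>\<^sup>+t. ennreal (indicator {0<..} t * (t powr (- a) / (1 + t))) \<partial>lborel) = ennreal (pi / sin (pi * a))"
proof -
  define F where "F = (\<lambda>t x :: real. ennreal (indicator {0<..} t * indicator {0<..} x * (t powr (- a) * exp (- (1 + t) * x))))"
  have Fm: "(\<lambda>(t, x). F t x) \<in> borel_measurable (lborel \<Otimes>\<^sub>M lborel)"
    unfolding F_def by measurable
  have 1: "ennreal (indicator {0<..} t * (t powr (- a) / (1 + t))) = (\<integral>\<^sup>+x. F t x \<partial>lborel)" for t
  proof (cases "t > 0")
    case t: True
    have "(\<integral>\<^sup>+x. F t x \<partial>lborel) = (\<integral>\<^sup>+x. ennreal (t powr (- a)) * ennreal (indicator {0<..} x * (x powr (1 - 1) * exp (- (1 + t) * x))) \<partial>lborel)"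
      using t unfolding F_def by (intro nn_integral_cong) (auto simp: indicator_def ennreal_mult')
    also have "\<dots> = ennreal (t powr (- a)) * ennreal (Gamma 1 * (1 + t) powr (- 1))"
      by (subst nn_integral_cmult) (use t nn_integral_Gamma_scaled[of 1 "1 + t"] in auto)
    also have "\<dots> = ennreal (indicator {0<..} t * (t powr (- a) / (1 + t)))"
      using t by (simp add: ennreal_mult'[symmetric] powr_minus divide_inverse)
    finally show ?thesis ..
  qed (auto simp: F_def)
  have 2: "(\<integral>\<^sup>+t. F t x \<partial>lborel) = ennreal (Gamma (1 - a)) * ennreal (indicator {0<..} x * (x powr (a - 1) * exp (- 1 * x)))" for x
  proof (cases "x > 0")
    case x: True
    have "(\<integral>\<^sup>+t. F t x \<partial>lborel) = (\<integral>\<^sup>+t. ennreal (exp (- x)) * ennreal (indicator {0<..} t * (t powr ((1 - a) - 1) * exp (- x * t))) \<partial>lborel)"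
      using x unfolding F_def
      by (intro nn_integral_cong) (auto simp: indicator_def ennreal_mult'[symmetric] exp_add[symmetric] algebra_simps)
    also have "\<dots> = ennreal (exp (- x)) * ennreal (Gamma (1 - a) * x powr (- (1 - a)))"
      by (subst nn_integral_cmult) (use x a nn_integral_Gamma_scaled[of "1 - a" x] in auto)
    also have "\<dots> = ennreal (Gamma (1 - a)) * ennreal (indicator {0<..} x * (x powr (a - 1) * exp (- 1 * x)))"
      using x a by (simp add: ennreal_mult'[symmetric] Gamma_real_pos less_imp_le mult_ac)
    finally show ?thesis .
  qed (auto simp: F_def)
  have "(\<integral>\<^sup>+t. ennreal (indicator {0<..} t * (t powr (- a) / (1 + t))) \<partial>lborel) = (\<integral>\<^sup>+t. \<integral>\<^sup>+x. F t x \<partial>lborel \<partial>lborel)"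
    by (simp only: 1)
  also have "\<dots> = (\<integral>\<^sup>+x. \<integral>\<^sup>+t. F t x \<partial>lborel \<partial>lborel)"
    using Fm by (rule lborel_pair.Fubini'[symmetric])
  also have "\<dots> = (\<integral>\<^sup>+x. ennreal (Gamma (1 - a)) * ennreal (indicator {0<..} x * (x powr (a - 1) * exp (- 1 * x))) \<partial>lborel)"
    by (simp only: 2)
  also have "\<dots> = ennreal (Gamma (1 - a)) * ennreal (Gamma a)"
    by (subst nn_integral_cmult) (use a nn_integral_Gamma_scaled[of a 1] in auto)
  also have "\<dots> = ennreal (Gamma a * Gamma (1 - a))"
    using a by (simp add: ennreal_mult'[symmetric] Gamma_real_pos less_imp_le mult.commute)
  also have "Gamma a * Gamma (1 - a) = pi / sin (pi * a)"
  proof -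
    have "complex_of_real (Gamma a * Gamma (1 - a)) = of_real (pi / sin (pi * a))"
      using Gamma_reflection_complex[of "of_real a"]
      by (simp add: Gamma_complex_of_real[symmetric] sin_of_real[symmetric])
    thus ?thesis by (simp only: of_real_eq_iff)
  qed
  finally show ?thesis .
qed

text \<open>The substitution t = u^2 in the preceding integral. The exponent a = (1 - s) / 2 makes 2
  u * u^(-2 a) equal to 2 u^s and sin (pi a) equal to cos (pi s / 2).\<close>

lemma nn_integral_powr_over_one_plus_square:
  fixes s :: real
  assumes s: "-1 < s" "s < 1"
  shows "(\<integral>\<^sup>+u. ennreal (indicator {0<..} u * (u powr s / (1 + u\<^sup>2))) \<partial>lborel) = ennreal (pi / (2 * cos (pi * s / 2)))"
proof -
  define a where "a = (1 - s) / 2"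
  have a: "0 < a" "a < 1" using s by (auto simp: a_def)
  define f where "f = (\<lambda>t::real. t powr (- a) / (1 + t))"
  have sinpos: "sin (pi * a) > 0" using a by (intro sin_gt_zero) simp_all
  have sc: "sin (pi * a) = cos (pi * s / 2)"
  proof -
    have "pi / 2 - pi * a = pi * s / 2" by (simp add: a_def field_simps)
    thus ?thesis by (simp only: sin_cos_eq of_real_eq_id id_apply)
  qed
  have "integrable lborel (\<lambda>t. indicator {0<..} t *\<^sub>R f t)"
  proof (rule integrableI_nonneg)
    show "(\<integral>\<^sup>+x. ennreal (indicator {0<..} x *\<^sub>R f x) \<partial>lborel) < \<infinity>"
      using nn_integral_Gamma_reflection[OF a] by (simp add: f_def)
  qed (auto simp: f_def indicator_def)
  hence fi: "set_integrable lborel {0<..} f" by (simp add: set_integrable_def)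
  have fv: "(LBINT t:{0<..}. f t) = pi / sin (pi * a)"
    unfolding set_lebesgue_integral_def
  proof (rule integral_eq_nn_integral[THEN trans])
    show "enn2real (\<integral>\<^sup>+x. ennreal (indicator {0<..} x *\<^sub>R f x) \<partial>lborel) = pi / sin (pi * a)"
      using nn_integral_Gamma_reflection[OF a] sinpos by (simp add: f_def)
  qed (auto simp: f_def indicator_def)
  have img: "(\<lambda>x::real. x\<^sup>2) ` {0<..} = {0<..}"
  proof (intro equalityI subsetI)
    fix y :: real assume "y \<in> {0<..}"
    thus "y \<in> (\<lambda>x::real. x\<^sup>2) ` {0<..}" by (intro image_eqI[of _ _ "sqrt y"]) auto
  qed auto
  \<comment> \<open>The change of variables is carried out for the completed measure; the way back
    to a nonnegative integral over \<open>lborel\<close> leads through the gauge integral.\<close>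
  have fabs: "f absolutely_integrable_on {0<..}"
    using fi borel_measurable_integrable[OF fi[unfolded set_integrable_def]]
    unfolding set_integrable_def by (simp add: integrable_completion)
  have "f absolutely_integrable_on ((\<lambda>x::real. x\<^sup>2) ` {0<..}) \<and> integral ((\<lambda>x::real. x\<^sup>2) ` {0<..}) f = pi / sin (pi * a)"
    unfolding img using fabs set_borel_integral_eq_integral(2)[OF fi] fv by simp
  hence *: "(\<lambda>x. \<bar>2 * x\<bar> * f (x\<^sup>2)) absolutely_integrable_on {0<..} \<and>
     integral {0<..} (\<lambda>x. \<bar>2 * x\<bar> * f (x\<^sup>2)) = pi / sin (pi * a)"
    by (subst has_absolute_integral_change_of_variables_1')
       (auto intro!: derivative_eq_intros simp: inj_on_def power2_eq_iff)
  have eq: "\<bar>2 * x\<bar> * f (x\<^sup>2) = 2 * (x powr s / (1 + x\<^sup>2))" if "x \<in> {0<..}" for x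
  proof -
    have "x * (x\<^sup>2) powr (- a) = x powr 1 * x powr (2 * (- a))"
      using that by (simp add: powr_powr flip: powr_numeral)
    also have "\<dots> = x powr s"
    proof -
      have "1 + 2 * (- a) = s" by (simp add: a_def field_simps)
      thus ?thesis by (simp only: powr_add[symmetric])
    qed
    finally have "x * (x\<^sup>2) powr (- a) = x powr s" .
    moreover have "\<bar>2 * x\<bar> * f (x\<^sup>2) = 2 * ((x * (x\<^sup>2) powr (- a)) / (1 + x\<^sup>2))"
      using that by (simp only: f_def) simp
    ultimately show ?thesis by (simp only:)
  qed
  have "(\<lambda>x. \<bar>2 * x\<bar> * f (x\<^sup>2)) integrable_on {0<..}"
    using * set_lebesgue_integral_eq_integral(1) by blast
  hence "((\<lambda>x. \<bar>2 * x\<bar> * f (x\<^sup>2)) has_integral (pi / sin (pi * a))) {0<..}"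
    using * by (simp add: has_integral_iff)
  hence "((\<lambda>x. 2 * (x powr s / (1 + x\<^sup>2))) has_integral (pi / sin (pi * a))) {0<..}"
    by (rule has_integral_eq[rotated]) (rule eq)
  from has_integral_mult_right[OF this, of "1/2"]
  have "((\<lambda>x. x powr s / (1 + x\<^sup>2)) has_integral (pi / (2 * sin (pi * a)))) {0<..}"
    by simp
  from nn_integral_has_integral_lebesgue[OF _ this] show ?thesis by (simp add: sc)
qed

subsection \<open>The Mellin transform of the truncated kernel\<close>

lemma zeta_kernel_measurable [measurable]: "zeta_kernel \<in> borel_measurable borel"
  unfolding zeta_kernel_def by measurable

text \<open>The majorant is twice the integrand of Gamma (\<sigma> + 1): the factor x in the bound
  on the kernel raises the exponent by one.\<close>

lemma zeta_kernel_integrable: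
  assumes \<sigma>: "\<sigma> > -1"
  shows "set_integrable lborel {0<..} (\<lambda>x. zeta_kernel x * x powr (\<sigma> - 1))"
  unfolding set_integrable_def
proof (rule Bochner_Integration.integrable_bound)
  show "integrable lborel (\<lambda>x. 2 * (indicator {0<..} x *\<^sub>R (x powr ((\<sigma> + 1) - 1) * exp (- 1 * x))))"
    using Gamma_integral_scaled_real(1)[of "\<sigma> + 1" 1] \<sigma> unfolding set_integrable_def
    by (intro integrable_mult_right) auto
  show "AE x in lborel. norm (indicator {0<..} x *\<^sub>R (zeta_kernel x * x powr (\<sigma> - 1)))
      \<le> norm (2 * (indicator {0<..} x *\<^sub>R (x powr ((\<sigma> + 1) - 1) * exp (- 1 * x))))"
  proof (intro AE_I2)
    fix x :: real
    show "norm (indicator {0<..} x *\<^sub>R (zeta_kernel x * x powr (\<sigma> - 1)))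
      \<le> norm (2 * (indicator {0<..} x *\<^sub>R (x powr ((\<sigma> + 1) - 1) * exp (- 1 * x))))"
    proof (cases "x > 0")
      case x: True
      have "\<bar>zeta_kernel x\<bar> * x powr (\<sigma> - 1) \<le> 2 * x * exp (- x) * x powr (\<sigma> - 1)"
        by (intro mult_right_mono zeta_kernel_bound x) auto
      also have "x * x powr (\<sigma> - 1) = x powr \<sigma>"
        using x by (simp add: powr_diff)
      hence "2 * x * exp (- x) * x powr (\<sigma> - 1) = 2 * (x powr \<sigma> * exp (- x))"
        by (simp add: mult_ac)
      finally show ?thesis using x by (simp add: abs_mult)
    qed auto
  qed
qed measurable

definition zeta_mellin :: "complex \<Rightarrow> complex" where
  "zeta_mellin s = (LBINT x:{0<..}. of_real (zeta_kernel x) * of_real x powr (s - 1))"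

lemma zeta_mellin_holomorphic: "zeta_mellin holomorphic_on {s. Re s > -1}"
  unfolding zeta_mellin_def[abs_def]
  by (rule Mellin_holomorphic) (auto intro: zeta_kernel_integrable)

lemma Mellin_of_real:
  fixes h :: "real \<Rightarrow> real" and \<sigma> :: real
  shows "(LBINT x:{0<..}. complex_of_real (h x) * of_real x powr (of_real \<sigma> - 1)) =
         of_real (LBINT x:{0<..}. h x * x powr (\<sigma> - 1))"
proof -
  have "of_real (h x) * of_real x powr (of_real \<sigma> - 1) = complex_of_real (h x * x powr (\<sigma> - 1))"
    if "x \<in> {0<..}" for x
    using that powr_of_real[of x "\<sigma> - 1"] by simp
  hence "(LBINT x:{0<..}. complex_of_real (h x) * of_real x powr (of_real \<sigma> - 1)) =
        (LBINT x:{0<..}. complex_of_real (h x * x powr (\<sigma> - 1)))"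
    by (intro set_lebesgue_integral_cong) auto
  thus ?thesis by (simp only: set_integral_complex_of_real)
qed

text \<open>Termwise integration of the partial fractions, justified by nonnegativity alone. Each
  term converges at 0 because s > -1, and the resulting series of (n + 1) powr (s - 1) converges
  because s < 0.\<close>

lemma bernoulli_tail_mellin_sums:
  fixes s :: real
  assumes s: "-1 < s" "s < 0"
  shows "set_integrable lborel {0<..} (\<lambda>x. bernoulli_tail x * x powr (s - 1))"
    and "(\<lambda>n. (2 * pi * (real n + 1)) powr (s - 1) * (pi / cos (pi * s / 2))) sums
           (LBINT x:{0<..}. bernoulli_tail x * x powr (s - 1))"
proof -
  define c where "c = (\<lambda>n. 2 * pi * (real n + 1))"
  have c: "c n > 0" for n unfolding c_def by (intro mult_pos_pos) auto
  define f where "f = (\<lambda>n x. indicator {0<..} x * (2 * x powr s / (x\<^sup>2 + (c n)\<^sup>2)))"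
  have f0: "f n x \<ge> 0" for n x by (simp add: f_def)
  have fm [measurable]: "f n \<in> borel_measurable borel" for n unfolding f_def by measurable
  have cs: "cos (pi * s / 2) > 0"
    using s mult_strict_left_mono[of "-1" s pi] by (intro cos_gt_zero_pi) (auto simp: field_simps mult_less_0_iff)
  define V where "V = (\<lambda>n. c n powr (s - 1) * (pi / cos (pi * s / 2)))"
  have V0: "V n \<ge> 0" for n using cs by (simp add: V_def)
  have I: "(\<integral>\<^sup>+x. ennreal (f n x) \<partial>lborel) = ennreal (V n)" for n
  proof -
    \<comment> \<open>Scaling by \<open>c n\<close> turns the denominator into (c n)^2 (1 + x^2), so
      one integral serves all n; with the Jacobian the powers of \<open>c n\<close> combine to the
      exponent s - 1.\<close>
    have "(\<integral>\<^sup>+x. ennreal (f n x) \<partial>lborel) = ennreal \<bar>c n\<bar> * (\<integral>\<^sup>+x. ennreal (f n (0 + c n * x)) \<partial>lborel)"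
      by (rule nn_integral_real_affine) (use c[of n] in auto)
    also have "(\<lambda>x. ennreal (f n (0 + c n * x))) =
        (\<lambda>x. ennreal (2 * c n powr (s - 2)) * ennreal (indicator {0<..} x * (x powr s / (1 + x\<^sup>2))))"
    proof
      fix x
      show "ennreal (f n (0 + c n * x)) = ennreal (2 * c n powr (s - 2)) * ennreal (indicator {0<..} x * (x powr s / (1 + x\<^sup>2)))"
      proof (cases "x > 0")
        case x: True
        have "(c n * x)\<^sup>2 + (c n)\<^sup>2 = (c n)\<^sup>2 * (1 + x\<^sup>2)" by (simp add: algebra_simps power2_eq_square)
        moreover have "(c n * x) powr s = c n powr (s - 2) * (c n)\<^sup>2 * x powr s"
          using c[of n] x by (simp add: powr_mult powr_diff flip: powr_numeral)
        ultimately have "f n (0 + c n * x) = 2 * c n powr (s - 2) * (x powr s / (1 + x\<^sup>2))"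
          using c[of n] x by (simp add: f_def indicator_def)
        thus ?thesis using x by (simp add: ennreal_mult'[symmetric])
      next
        case False
        thus ?thesis using c[of n] by (simp add: f_def indicator_def zero_less_mult_iff)
      qed
    qed
    also have "(\<integral>\<^sup>+x. ennreal (2 * c n powr (s - 2)) * ennreal (indicator {0<..} x * (x powr s / (1 + x\<^sup>2))) \<partial>lborel) =
        ennreal (2 * c n powr (s - 2)) * ennreal (pi / (2 * cos (pi * s / 2)))"
      using nn_integral_powr_over_one_plus_square[of s] s by (subst nn_integral_cmult) auto
    also have "ennreal \<bar>c n\<bar> * \<dots> = ennreal (c n * (2 * c n powr (s - 2) * (pi / (2 * cos (pi * s / 2)))))"
      using c[of n] cs by (simp add: ennreal_mult'[symmetric] ennreal_mult''[symmetric])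
    also have "c n * (2 * c n powr (s - 2) * (pi / (2 * cos (pi * s / 2)))) = V n"
    proof -
      have "c n * c n powr (s - 2) = c n powr (s - 1)"
        using c[of n] powr_add[of "c n" 1 "s - 2"] by simp
      thus ?thesis by (simp add: V_def field_simps)
    qed
    finally show ?thesis .
  qed
  have fs: "(\<lambda>n. f n x) sums (indicator {0<..} x * (bernoulli_tail x * x powr (s - 1)))" for x
  proof (cases "x > 0")
    case x: True
    have "(\<lambda>n. x powr (s - 1) * (2 * x / (x\<^sup>2 + (c n)\<^sup>2))) sums (x powr (s - 1) * bernoulli_tail x)"
      unfolding c_def by (intro sums_mult bernoulli_tail_sums x)
    moreover have "x powr s = x * x powr (s - 1)" using x by (simp add: powr_diff)
    ultimately show ?thesis using x by (simp add: f_def mult_ac)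
  qed (auto simp: f_def)
  have Vsum: "summable V"
  proof -
    have "summable (\<lambda>n. real (Suc n) powr (s - 1))"
      using summable_Suc_iff[of "\<lambda>n. real n powr (s - 1)"] summable_real_powr_iff[of "s - 1"] s by simp
    from summable_mult[OF this, of "(2 * pi) powr (s - 1) * (pi / cos (pi * s / 2))"]
    moreover have "V n = (2 * pi) powr (s - 1) * (pi / cos (pi * s / 2)) * real (Suc n) powr (s - 1)" for n
      unfolding V_def c_def by (subst powr_mult) (simp_all add: add.commute)
    ultimately show ?thesis by presburger
  qed
  have tot: "(\<integral>\<^sup>+x. ennreal (indicator {0<..} x * (bernoulli_tail x * x powr (s - 1))) \<partial>lborel) = ennreal (suminf V)"
  proof -
    have "ennreal (indicator {0<..} x * (bernoulli_tail x * x powr (s - 1))) = (\<Sum>n. ennreal (f n x))" for x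
      using fs[of x] f0 by (subst suminf_ennreal2) (auto simp: sums_iff)
    hence "(\<integral>\<^sup>+x. ennreal (indicator {0<..} x * (bernoulli_tail x * x powr (s - 1))) \<partial>lborel) =
      (\<Sum>n. \<integral>\<^sup>+x. ennreal (f n x) \<partial>lborel)"
      by (simp add: nn_integral_suminf)
    also have "\<dots> = ennreal (suminf V)"
      unfolding I using Vsum V0 by (intro suminf_ennreal2) auto
    finally show ?thesis .
  qed
  have nn: "indicator {0<..} x * (bernoulli_tail x * x powr (s - 1)) \<ge> 0" for x
    by (cases "x > 0") (auto simp: bernoulli_tail_nonneg)
  have bm [measurable]: "bernoulli_tail \<in> borel_measurable borel"
    unfolding bernoulli_tail_def by measurable
  show "set_integrable lborel {0<..} (\<lambda>x. bernoulli_tail x * x powr (s - 1))"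
    unfolding set_integrable_def
    by (rule integrableI_nonneg) (use nn tot in \<open>auto\<close>)
  have "(LBINT x:{0<..}. bernoulli_tail x * x powr (s - 1)) = suminf V"
    unfolding set_lebesgue_integral_def
    by (subst integral_eq_nn_integral) (use nn tot suminf_nonneg[OF Vsum V0] in auto)
  thus "(\<lambda>n. (2 * pi * (real n + 1)) powr (s - 1) * (pi / cos (pi * s / 2))) sums
           (LBINT x:{0<..}. bernoulli_tail x * x powr (s - 1))"
    using Vsum unfolding V_def c_def by (simp add: sums_iff)
qed

text \<open>The two kernels differ only beyond 1, by 1 / x - 1 / 2 for x > 1. For s < 0 this
  difference has a convergent transform over that half-line, which gives the two rational
  terms.\<close>

lemma zeta_mellin_left:
  fixes s :: real
  assumes s: "-1 < s" "s < 0"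
  shows "zeta_mellin (of_real s) =
     of_real ((LBINT x:{0<..}. bernoulli_tail x * x powr (s - 1)) + 1 / (2 * s) - 1 / (s - 1))"
proof -
  have "((\<lambda>x. bernoulli_tail x * x powr (s - 1)) has_integral
           (LBINT x:{0<..}. bernoulli_tail x * x powr (s - 1))) {0<..}"
    using set_borel_integral_eq_integral[OF bernoulli_tail_mellin_sums(1)[OF s]] by (simp add: has_integral_iff)
  moreover have "((\<lambda>x. x powr (s - 2) - (1/2) * x powr (s - 1)) has_integral
          (- (1 powr (s - 2 + 1)) / (s - 2 + 1) - 1/2 * (- (1 powr (s - 1 + 1)) / (s - 1 + 1)))) {1..}"
    using s by (intro has_integral_diff has_integral_mult_right has_integral_powr_to_inf) auto
  hence "((\<lambda>x. if x \<in> {1..} then x powr (s - 2) - (1/2) * x powr (s - 1) else 0) has_integral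
          (1 / (2 * s) - 1 / (s - 1))) {0<..}"
    using s by (subst has_integral_restrict) (auto simp: algebra_simps)
  ultimately have "((\<lambda>x. bernoulli_tail x * x powr (s - 1) +
        (if x \<in> {1..} then x powr (s - 2) - (1/2) * x powr (s - 1) else 0)) has_integral
      ((LBINT x:{0<..}. bernoulli_tail x * x powr (s - 1)) + (1 / (2 * s) - 1 / (s - 1)))) {0<..}"
    by (rule has_integral_add)
  hence "((\<lambda>x. zeta_kernel x * x powr (s - 1)) has_integral
      ((LBINT x:{0<..}. bernoulli_tail x * x powr (s - 1)) + (1 / (2 * s) - 1 / (s - 1)))) {0<..}"
  \<comment> \<open>At x = 1 the truncation and the case distinction disagree; a single point is
    negligible.\<close>
  proof (rule has_integral_spike[of "{1}", rotated 2])
    fix x :: real assume x: "x \<in> {0<..} - {1}"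
    have "x powr (s - 2) = x powr (s - 1) / x"
      using x powr_diff[of x "s - 1" 1] by simp
    thus "zeta_kernel x * x powr (s - 1) = bernoulli_tail x * x powr (s - 1) +
        (if x \<in> {1..} then x powr (s - 2) - (1/2) * x powr (s - 1) else 0)"
      using x by (auto simp: zeta_kernel_def bernoulli_tail_def algebra_simps)
  qed simp
  moreover have "((\<lambda>x. zeta_kernel x * x powr (s - 1)) has_integral
      (LBINT x:{0<..}. zeta_kernel x * x powr (s - 1))) {0<..}"
    using set_borel_integral_eq_integral[OF zeta_kernel_integrable[of s]] s by (simp add: has_integral_iff)
  ultimately have "(LBINT x:{0<..}. zeta_kernel x * x powr (s - 1)) =
      (LBINT x:{0<..}. bernoulli_tail x * x powr (s - 1)) + (1 / (2 * s) - 1 / (s - 1))"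
    by (rule has_integral_unique[symmetric])
  thus ?thesis by (simp add: zeta_mellin_def Mellin_of_real)
qed

subsection \<open>The Dirichlet series as a Mellin transform\<close>

lemma exp_series_minus_one:
  fixes x :: real
  assumes "x > 0"
  shows "(\<lambda>n. exp (- (real n + 1) * x)) sums (1 / (exp x - 1))"
proof -
  have "(\<lambda>n. exp (- x) * exp (- x) ^ n) sums (exp (- x) * (1 / (1 - exp (- x))))"
    using assms by (intro sums_mult geometric_sums) auto
  also have "(\<lambda>n. exp (- x) * exp (- x) ^ n) = (\<lambda>n. exp (- (real n + 1) * x))"
    by (simp add: exp_of_nat_mult[symmetric] exp_add[symmetric] algebra_simps)
  also have "exp (- x) * (1 / (1 - exp (- x))) = 1 / (exp x - 1)"
    using assms by (simp add: exp_minus field_simps)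
  finally show ?thesis .
qed

text \<open>Geometric expansion of the kernel and termwise integration. The norms of the terms
  integrate to Gamma (Re s) * (n + 1) powr (- Re s), which is summable for Re s > 1.\<close>

lemma Dirichlet_series_Mellin:
  fixes s :: complex
  assumes s: "Re s > 1"
  shows "set_integrable lborel {0<..} (\<lambda>x. of_real (1 / (exp x - 1)) * of_real x powr (s - 1))"
    and "(\<lambda>n. Gamma s * of_nat (Suc n) powr (- s)) sums
           (LBINT x:{0<..}. of_real (1 / (exp x - 1)) * of_real x powr (s - 1))"
proof -
  define f where "f = (\<lambda>n x. indicator {0<..} x *\<^sub>R
     (of_real x powr (s - 1) * complex_of_real (exp (- (real n + 1) * x))))"
  have s0: "Re s > 0" using s by simp
  have n0: "real n + 1 > 0" for n by simp
  have int: "integrable lborel (f n)" for n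
    using Gamma_integral_scaled(1)[OF s0 n0[of n]] by (simp add: f_def set_integrable_def)
  have val: "integral\<^sup>L lborel (f n) = Gamma s * of_nat (Suc n) powr (- s)" for n
    using Gamma_integral_scaled(2)[OF s0 n0[of n]] by (simp add: f_def set_lebesgue_integral_def add.commute)
  have norm_f: "norm (f n x) = indicator {0<..} x *\<^sub>R (x powr (Re s - 1) * exp (- (real n + 1) * x))" for n x
    by (auto simp: f_def indicator_def norm_mult norm_powr_real_powr)
  have nval: "(\<integral>x. norm (f n x) \<partial>lborel) = Gamma (Re s) * real (Suc n) powr (- Re s)" for n
    using Gamma_integral_scaled_real(2)[OF s0 n0[of n]]
    unfolding norm_f set_lebesgue_integral_def by (simp add: add.commute)
  have exps: "(\<lambda>n. f n x) sums (indicator {0<..} x *\<^sub>R (of_real (1 / (exp x - 1)) * of_real x powr (s - 1)))"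
    and nexps: "summable (\<lambda>n. norm (f n x))" for x
  proof -
    have "(\<lambda>n. f n x) sums (indicator {0<..} x *\<^sub>R (of_real (1 / (exp x - 1)) * of_real x powr (s - 1))) \<and>
       summable (\<lambda>n. norm (f n x))"
    proof (cases "x > 0")
      case x: True
      note e = exp_series_minus_one[OF x]
      have "(\<lambda>n. of_real x powr (s - 1) * complex_of_real (exp (- (real n + 1) * x))) sums
              (of_real x powr (s - 1) * of_real (1 / (exp x - 1)))"
        by (intro sums_mult) (use e in \<open>simp only: sums_of_real_iff\<close>)
      moreover have "summable (\<lambda>n. x powr (Re s - 1) * exp (- (real n + 1) * x))"
        using sums_mult[OF e] by (rule sums_summable)
      ultimately show ?thesis unfolding norm_f using x by (simp add: f_def mult.commute)
    qed (auto simp: f_def)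
    thus "(\<lambda>n. f n x) sums (indicator {0<..} x *\<^sub>R (of_real (1 / (exp x - 1)) * of_real x powr (s - 1)))"
      "summable (\<lambda>n. norm (f n x))" by blast+
  qed
  have S: "summable (\<lambda>n. \<integral>x. norm (f n x) \<partial>lborel)"
    unfolding nval using summable_Suc_iff[of "\<lambda>n. real n powr (- Re s)"] summable_real_powr_iff[of "- Re s"] s
    by (intro summable_mult) simp
  have eq: "(\<lambda>x. \<Sum>n. f n x) = (\<lambda>x. indicator {0<..} x *\<^sub>R (of_real (1 / (exp x - 1)) * of_real x powr (s - 1)))"
    using exps by (auto simp: sums_iff)
  show "set_integrable lborel {0<..} (\<lambda>x. of_real (1 / (exp x - 1)) * of_real x powr (s - 1))"
    unfolding set_integrable_def eq[symmetric] using int nexps S by (intro integrable_suminf) auto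
  show "(\<lambda>n. Gamma s * of_nat (Suc n) powr (- s)) sums
           (LBINT x:{0<..}. of_real (1 / (exp x - 1)) * of_real x powr (s - 1))"
    unfolding set_lebesgue_integral_def eq[symmetric] val[symmetric]
    using int nexps S by (intro sums_integral) auto
qed

lemma set_integrable_Dirichlet_kernel:
  fixes \<sigma> :: real
  assumes \<sigma>: "\<sigma> > 1"
  shows "set_integrable lborel {0<..} (\<lambda>x. 1 / (exp x - 1) * x powr (\<sigma> - 1))"
proof -
  have "set_integrable lborel {0<..} (\<lambda>x. cmod (of_real (1 / (exp x - 1)) * of_real x powr (of_real \<sigma> - 1)))"
    by (rule set_integrable_norm, rule Dirichlet_series_Mellin(1)) (use \<sigma> in simp)
  also have "?this \<longleftrightarrow> set_integrable lborel {0<..} (\<lambda>x. 1 / (exp x - 1) * x powr (\<sigma> - 1))"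
  proof (rule set_integrable_cong)
    fix x :: real assume x: "x \<in> {0<..}"
    have "cmod (of_real (1 / (exp x - 1)) * of_real x powr (of_real \<sigma> - 1)) =
            \<bar>1 / (exp x - 1)\<bar> * cmod (of_real x powr (of_real \<sigma> - 1))"
      by (simp only: norm_mult norm_of_real)
    thus "cmod (of_real (1 / (exp x - 1)) * of_real x powr (of_real \<sigma> - 1)) =
            1 / (exp x - 1) * x powr (\<sigma> - 1)"
      using x by (simp add: norm_powr_real_powr)
  qed simp_all
  finally show ?thesis .
qed

text \<open>The identity theorem with the midpoint of the interval as limit point. It allows the
  transforms to be evaluated at real arguments only.\<close>

lemma holomorphic_eq_on_real_interval:
  fixes f g :: "complex \<Rightarrow> complex" and a b :: real
  assumes "f holomorphic_on S" "g holomorphic_on S" "open S" "connected S"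
    and ab: "a < b" and sub: "\<And>x. a < x \<Longrightarrow> x < b \<Longrightarrow> complex_of_real x \<in> S"
    and eq: "\<And>x. a < x \<Longrightarrow> x < b \<Longrightarrow> f (of_real x) = g (of_real x)"
    and z: "z \<in> S"
  shows "f z = g z"
proof -
  define U where "U = complex_of_real ` {a<..<b}"
  define m where "m = (a + b) / 2"
  have m: "a < m" "m < b" using ab by (simp_all add: m_def)
  have "(\<lambda>z. f z - g z) holomorphic_on S" using assms by (intro holomorphic_intros)
  moreover have "U \<subseteq> S" using sub by (auto simp: U_def)
  moreover have "of_real m \<in> S" using sub m by blast
  moreover have "complex_of_real m islimpt U"
  proof (subst islimpt_approachable, intro allI impI)
    fix e :: real assume e: "e > 0"
    define d where "d = min (e / 2) ((b - m) / 2)"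
    have d: "d > 0" "d < e" "m + d < b" using e m by (auto simp: d_def min_def field_simps)
    show "\<exists>x'\<in>U. x' \<noteq> complex_of_real m \<and> dist x' (complex_of_real m) < e"
    proof (rule bexI[of _ "complex_of_real (m + d)"])
      show "complex_of_real (m + d) \<in> U" using d m unfolding U_def by (intro imageI) auto
      show "complex_of_real (m + d) \<noteq> complex_of_real m \<and> dist (complex_of_real (m + d)) (complex_of_real m) < e"
        using d by (simp add: dist_of_real dist_real_def del: of_real_add)
    qed
  qed
  moreover have "\<And>z. z \<in> U \<Longrightarrow> f z - g z = 0" using eq by (auto simp: U_def)
  ultimately have "f z - g z = 0"
    using analytic_continuation[of "\<lambda>z. f z - g z" S U "of_real m" z] assms by blast
  thus ?thesis by simp
qed

text \<open>Counterpart of \<open>zeta_mellin_left\<close>: for s > 1 the part subtracted on (0, 1)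
  has a convergent transform of its own.\<close>

lemma zeta_mellin_right_real:
  fixes s :: real
  assumes s: "s > 1"
  shows "zeta_mellin (of_real s) =
     of_real ((LBINT x:{0<..}. 1 / (exp x - 1) * x powr (s - 1)) - 1 / (s - 1) + 1 / (2 * s))"
proof -
  have "((\<lambda>x. 1 / (exp x - 1) * x powr (s - 1)) has_integral
           (LBINT x:{0<..}. 1 / (exp x - 1) * x powr (s - 1))) {0<..}"
    using set_borel_integral_eq_integral[OF set_integrable_Dirichlet_kernel[OF s]] by (simp only: has_integral_iff)
  moreover have "((\<lambda>x. x powr (s - 2) - (1/2) * x powr (s - 1)) has_integral
          (1 powr (s - 2 + 1) / (s - 2 + 1) - 1/2 * (1 powr (s - 1 + 1) / (s - 1 + 1)))) {0..1}"
    using s by (intro has_integral_diff has_integral_mult_right has_integral_powr_from_0) auto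
  hence "((\<lambda>x. x powr (s - 2) - (1/2) * x powr (s - 1)) has_integral
          (1 / (s - 1) - 1 / (2 * s))) {0<..<1}"
    using s by (simp add: has_integral_Icc_iff_Ioo algebra_simps)
  hence "((\<lambda>x. if x \<in> {0<..<1} then x powr (s - 2) - (1/2) * x powr (s - 1) else 0) has_integral
          (1 / (s - 1) - 1 / (2 * s))) {0<..}"
    by (subst has_integral_restrict) auto
  ultimately have "((\<lambda>x. 1 / (exp x - 1) * x powr (s - 1) -
        (if x \<in> {0<..<1} then x powr (s - 2) - (1/2) * x powr (s - 1) else 0)) has_integral
      ((LBINT x:{0<..}. 1 / (exp x - 1) * x powr (s - 1)) - (1 / (s - 1) - 1 / (2 * s)))) {0<..}"
    by (rule has_integral_diff)
  hence "((\<lambda>x. zeta_kernel x * x powr (s - 1)) has_integral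
      ((LBINT x:{0<..}. 1 / (exp x - 1) * x powr (s - 1)) - (1 / (s - 1) - 1 / (2 * s)))) {0<..}"
  proof (rule has_integral_spike[of "{1}", rotated 2])
    fix x :: real assume x: "x \<in> {0<..} - {1}"
    have "x powr (s - 2) = x powr (s - 1) / x"
      using x powr_diff[of x "s - 1" 1] by simp
    thus "zeta_kernel x * x powr (s - 1) = 1 / (exp x - 1) * x powr (s - 1) -
        (if x \<in> {0<..<1} then x powr (s - 2) - (1/2) * x powr (s - 1) else 0)"
      using x by (auto simp: zeta_kernel_def algebra_simps)
  qed simp
  moreover have "((\<lambda>x. zeta_kernel x * x powr (s - 1)) has_integral
      (LBINT x:{0<..}. zeta_kernel x * x powr (s - 1))) {0<..}"
    using set_borel_integral_eq_integral[OF zeta_kernel_integrable[of s]] s by (simp add: has_integral_iff)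
  ultimately have "(LBINT x:{0<..}. zeta_kernel x * x powr (s - 1)) =
      (LBINT x:{0<..}. 1 / (exp x - 1) * x powr (s - 1)) - (1 / (s - 1) - 1 / (2 * s))"
    by (rule has_integral_unique[symmetric])
  thus ?thesis by (simp add: zeta_mellin_def Mellin_of_real)
qed

lemma zeta_mellin_right:
  assumes s: "Re s > 1"
  shows "zeta_mellin s = (LBINT x:{0<..}. of_real (1 / (exp x - 1)) * of_real x powr (s - 1))
           - 1 / (s - 1) + 1 / (2 * s)"
proof -
  define D where "D = (\<lambda>s. LBINT x:{0<..}. complex_of_real (1 / (exp x - 1)) * of_real x powr (s - 1))"
  have "D holomorphic_on {s. Re s > 1}"
    unfolding D_def by (rule Mellin_holomorphic) (measurable, rule set_integrable_Dirichlet_kernel)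
  hence D: "(\<lambda>s. D s - 1 / (s - 1) + 1 / (2 * s)) holomorphic_on {s. Re s > 1}"
    by (intro holomorphic_intros) auto
  have M: "zeta_mellin holomorphic_on {s. 1 < Re s}"
    by (rule holomorphic_on_subset[OF zeta_mellin_holomorphic]) auto
  have "connected {s. 1 < Re s}" by (intro convex_connected convex_halfspace_Re_gt)
  note * = holomorphic_eq_on_real_interval[OF M D open_halfspace_Re_gt this, of 1 2]
  have "zeta_mellin s = D s - 1 / (s - 1) + 1 / (2 * s)"
  proof (rule *)
    fix x :: real assume "1 < x" "x < 2"
    thus "zeta_mellin (of_real x) = D (of_real x) - 1 / (of_real x - 1) + 1 / (2 * of_real x)"
      unfolding D_def Mellin_of_real by (subst zeta_mellin_right_real) simp_all
  qed (use s in auto)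
  thus ?thesis by (simp only: D_def)
qed

subsection \<open>Analytic continuation and functional equation\<close>

text \<open>The relation Gamma s * zeta s = zeta_mellin s + 1 / (s - 1) - 1 / (2 s), solved for
  zeta. Writing rGamma s / s as rGamma (s + 1) removes the apparent singularity at 0.\<close>

definition zeta_right :: "complex \<Rightarrow> complex" where
  "zeta_right s = rGamma s * zeta_mellin s + rGamma s / (s - 1) - rGamma (s + 1) / 2"

lemma zeta_right_holomorphic: "zeta_right holomorphic_on {s. Re s > -1} - {1}"
  unfolding zeta_right_def[abs_def]
  by (intro holomorphic_intros holomorphic_on_subset[OF zeta_mellin_holomorphic]) auto

lemma zeta_right_sums:
  assumes s: "Re s > 1"
  shows "(\<lambda>n. 1 / of_nat (Suc n) powr s) sums zeta_right s"
proof -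
  define D where "D = (LBINT x:{0<..}. complex_of_real (1 / (exp x - 1)) * of_real x powr (s - 1))"
  have s0: "s \<notin> \<int>\<^sub>\<le>\<^sub>0" "s \<noteq> 0" "s \<noteq> 1" using s by (auto elim!: nonpos_Ints_cases)
  have "(\<lambda>n. rGamma s * (Gamma s * of_nat (Suc n) powr (- s))) sums (rGamma s * D)"
    unfolding D_def by (intro sums_mult Dirichlet_series_Mellin s)
  also have "(\<lambda>n. rGamma s * (Gamma s * of_nat (Suc n) powr (- s))) = (\<lambda>n. 1 / of_nat (Suc n) powr s)"
  proof -
    have "rGamma s \<noteq> 0" using s0 by (simp add: rGamma_eq_zero_iff)
    thus ?thesis by (simp add: Gamma_def powr_minus divide_inverse mult.assoc[symmetric])
  qed
  also have "rGamma s * D = zeta_right s"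
  proof -
    have "zeta_mellin s = D - 1 / (s - 1) + 1 / (2 * s)"
      unfolding D_def by (rule zeta_mellin_right[OF s])
    moreover have "rGamma s / (2 * s) = rGamma (s + 1) / 2"
      using s0 rGamma_plus1[of s, symmetric] by simp
    ultimately show ?thesis
      by (simp add: zeta_right_def distrib_left right_diff_distrib)
  qed
  finally show ?thesis .
qed

text \<open>The rational terms of \<open>zeta_mellin_left\<close> cancel those in
  \<open>zeta_right\<close>, leaving rGamma s times the transform of \<open>bernoulli_tail\<close>.
  The series of that transform is a multiple of the Dirichlet series at 1 - s > 1.\<close>

lemma zeta_right_reflection_real:
  fixes s :: real
  assumes s: "-1 < s" "s < 0"
  shows "zeta_right (of_real s) = 2 * (2 * of_real pi) powr (of_real s - 1) * sin (of_real pi * of_real s / 2) *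
           Gamma (1 - of_real s) * zeta_right (1 - of_real s)"
proof -
  define I where "I = (LBINT x:{0<..}. bernoulli_tail x * x powr (s - 1))"
  define S C where "S = sin (pi * s / 2)" and "C = cos (pi * s / 2)"
  have C0: "C > 0" unfolding C_def
    using s mult_strict_left_mono[of "-1" s pi] by (intro cos_gt_zero_pi) (auto simp: field_simps mult_less_0_iff)
  have A: "zeta_right (of_real s) = rGamma (of_real s) * of_real I"
  proof -
    have "rGamma (of_real s) / (2 * of_real s) = rGamma (of_real s + 1 :: complex) / 2"
      using s rGamma_plus1[of "complex_of_real s", symmetric] by simp
    thus ?thesis
      by (simp add: zeta_right_def zeta_mellin_left[OF s] I_def[symmetric] distrib_left right_diff_distrib)
  qed
  have B: "of_real I = (2 * of_real pi) powr (of_real s - 1) * of_real (pi / C) * zeta_right (1 - of_real s)"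
  proof -
    have "(\<lambda>n. complex_of_real ((2 * pi * (real n + 1)) powr (s - 1) * (pi / C))) sums (of_real I)"
      unfolding I_def C_def sums_of_real_iff by (rule bernoulli_tail_mellin_sums[OF s])
    moreover have "(\<lambda>n. (2 * of_real pi) powr (of_real s - 1) * of_real (pi / C) *
          (1 / of_nat (Suc n) powr (1 - of_real s))) sums
          ((2 * of_real pi) powr (of_real s - 1) * of_real (pi / C) * zeta_right (1 - of_real s))"
      by (intro sums_mult zeta_right_sums) (use s in simp)
    moreover have "complex_of_real ((2 * pi * (real n + 1)) powr (s - 1) * (pi / C)) =
       (2 * of_real pi) powr (of_real s - 1) * of_real (pi / C) *
          (1 / of_nat (Suc n) powr (1 - of_real s))" for n
    proof -
      have "(2 * pi * (real n + 1)) powr (s - 1) = (2 * pi) powr (s - 1) * real (Suc n) powr (s - 1)"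
        by (subst powr_mult) (simp_all add: add.commute)
      hence "complex_of_real ((2 * pi * (real n + 1)) powr (s - 1)) =
             of_real (2 * pi) powr of_real (s - 1) * of_real (real (Suc n)) powr of_real (s - 1)"
        by (subst (1 2) powr_of_real) simp_all
      also have "of_real (real (Suc n)) powr complex_of_real (s - 1) = 1 / of_nat (Suc n) powr (1 - of_real s)"
        using powr_minus[of "of_nat (Suc n) :: complex" "1 - of_real s"] by (simp add: divide_inverse)
      finally show ?thesis by simp
    qed
    ultimately show ?thesis using sums_unique2 by simp
  qed
  \<comment> \<open>Reflection gives rGamma s * rGamma (1 - s) = sin (pi s) / pi; the double angle
    formula then cancels the cosine left by the integral.\<close>
  have E: "rGamma (of_real s) * of_real (pi / C) = 2 * of_real S * Gamma (1 - complex_of_real s)"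
  proof -
    have "1 - complex_of_real s \<notin> \<int>\<^sub>\<le>\<^sub>0"
      using s by (auto elim!: nonpos_Ints_cases simp: complex_eq_iff)
    hence "rGamma (1 - complex_of_real s) \<noteq> 0" by (simp add: rGamma_eq_zero_iff)
    moreover have "rGamma (of_real s) * rGamma (1 - complex_of_real s) = of_real (2 * S * C / pi)"
    proof -
      have "2 * S * C = sin (pi * s)"
        using sin_double[of "pi * s / 2"] by (simp add: S_def C_def)
      thus ?thesis using rGamma_reflection_complex[of "of_real s"]
        by (simp add: sin_of_real[symmetric])
    qed
    ultimately have "rGamma (of_real s) = of_real (2 * S * C / pi) * Gamma (1 - complex_of_real s)"
      by (simp add: Gamma_def field_simps)
    thus ?thesis using C0 by simp
  qed
  have F: "sin (of_real pi * complex_of_real s / 2) = of_real S"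
    by (simp add: S_def sin_of_real[symmetric])
  have "zeta_right (of_real s) = (rGamma (of_real s) * of_real (pi / C)) *
          ((2 * of_real pi) powr (of_real s - 1) * zeta_right (1 - of_real s))"
    unfolding A B by (simp only: mult_ac)
  thus ?thesis unfolding E F by (simp only: mult_ac)
qed

text \<open>The identity spreads from (-1, 0) over the strip, which contains the critical line. The
  point 0 is taken out because 1 - s would hit the excluded point 1; the punctured strip stays
  connected.\<close>

lemma zeta_right_reflection:
  assumes s: "-1 < Re s" "Re s < 1" "s \<noteq> 0"
  shows "zeta_right s = 2 * (2 * of_real pi) powr (s - 1) * sin (of_real pi * s / 2) *
           Gamma (1 - s) * zeta_right (1 - s)"
proof -
  define S where "S = {s. -1 < Re s} \<inter> {s. Re s < 1} - {0}"
  have oS: "open ({s. -1 < Re s} \<inter> {s. Re s < 1})"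
    by (intro open_Int open_halfspace_Re_gt open_halfspace_Re_lt)
  have cS: "connected ({s. -1 < Re s} \<inter> {s. Re s < 1})"
    by (intro convex_connected convex_Int convex_halfspace_Re_gt convex_halfspace_Re_lt)
  have R: "zeta_right holomorphic_on S"
    by (rule holomorphic_on_subset[OF zeta_right_holomorphic]) (auto simp: S_def)
  have "(zeta_right \<circ> (\<lambda>s. 1 - s)) holomorphic_on S"
    by (rule holomorphic_on_compose_gen[OF _ zeta_right_holomorphic])
       (auto simp: S_def complex_eq_iff intro!: holomorphic_intros)
  hence R': "(\<lambda>s. zeta_right (1 - s)) holomorphic_on S" by (simp add: o_def)
  have L: "(\<lambda>s. 2 * (2 * of_real pi) powr (s - 1) * sin (of_real pi * s / 2) *
           Gamma (1 - s) * zeta_right (1 - s)) holomorphic_on S"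
    by (intro holomorphic_intros R')
       (auto simp: S_def complex_nonpos_Reals_iff complex_eq_iff elim!: nonpos_Ints_cases)
  show ?thesis
  proof (rule holomorphic_eq_on_real_interval[OF R L, of "-1" 0])
    show "open S" unfolding S_def by (intro open_Diff oS closed_singleton)
    show "connected S" unfolding S_def using oS cS by (rule connected_open_delete) simp
  qed (use s zeta_right_reflection_real in \<open>auto simp: S_def\<close>)
qed

text \<open>The functional equation itself supplies the continuation to Re s \<le> -1; the value at
  1 follows the convention of \<open>zeta\<close>.\<close>

definition zeta_glued :: "complex \<Rightarrow> complex" where
  "zeta_glued s = (if s = 1 then 0 else if Re s > -1 then zeta_right s
     else 2 * (2 * of_real pi) powr (s - 1) * sin (of_real pi * s / 2) * Gamma (1 - s) * zeta_right (1 - s))"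

text \<open>Two open sets cover the punctured plane. On Re s < 0 the reflected formula holds
  throughout, since it agrees with \<open>zeta_right\<close> for -1 < Re s < 0.\<close>

lemma zeta_glued_holomorphic: "zeta_glued holomorphic_on - {1}"
proof -
  have "zeta_glued holomorphic_on {s. Re s > -1} - {1}"
    by (rule holomorphic_transform[OF zeta_right_holomorphic]) (auto simp: zeta_glued_def)
  moreover have "zeta_glued holomorphic_on {s. Re s < 0}"
  proof -
    have "(zeta_right \<circ> (\<lambda>s. 1 - s)) holomorphic_on {s. Re s < 0}"
      by (rule holomorphic_on_compose_gen[OF _ zeta_right_holomorphic])
         (auto simp: complex_eq_iff intro!: holomorphic_intros)
    hence R': "(\<lambda>s. zeta_right (1 - s)) holomorphic_on {s. Re s < 0}" by (simp add: o_def)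
    have L: "(\<lambda>s. 2 * (2 * of_real pi) powr (s - 1) * sin (of_real pi * s / 2) *
             Gamma (1 - s) * zeta_right (1 - s)) holomorphic_on {s. Re s < 0}"
      by (intro holomorphic_intros R')
         (auto simp: complex_nonpos_Reals_iff complex_eq_iff elim!: nonpos_Ints_cases)
    show ?thesis
    proof (rule holomorphic_transform[OF L])
      fix s :: complex assume "s \<in> {s. Re s < 0}"
      hence "Re s < 0" "s \<noteq> 0" by auto
      thus "2 * (2 * of_real pi) powr (s - 1) * sin (of_real pi * s / 2) * Gamma (1 - s) * zeta_right (1 - s) = zeta_glued s"
        using zeta_right_reflection[of s] by (auto simp: zeta_glued_def)
    qed
  qed
  ultimately have "zeta_glued holomorphic_on ({s. Re s > -1} - {1}) \<union> {s. Re s < 0}"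
    by (intro holomorphic_on_Un open_Diff open_halfspace_Re_gt open_halfspace_Re_lt closed_singleton)
  also have "({s. Re s > -1} - {1}) \<union> {s. Re s < 0} = - {1::complex}" by auto
  finally show ?thesis .
qed

text \<open>Makes the definite description usable: two candidates agree on Re s > 1, hence on the
  connected punctured plane, and at 1 both are 0.\<close>

lemma zeta_eqI:
  assumes f: "f holomorphic_on - {1}" "f 1 = 0"
    "\<And>s. Re s > 1 \<Longrightarrow> (\<lambda>n. 1 / of_nat (Suc n) powr s) sums f s"
  shows "zeta = f"
  unfolding zeta_def
proof (rule the_equality)
  show "f holomorphic_on - {1} \<and> f 1 = 0 \<and> (\<forall>s. Re s > 1 \<longrightarrow> (\<lambda>n. 1 / of_nat (Suc n) powr s) sums f s)"
    using f by blast
next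
  fix g assume g: "g holomorphic_on - {1} \<and> g 1 = 0 \<and> (\<forall>s. Re s > 1 \<longrightarrow> (\<lambda>n. 1 / of_nat (Suc n) powr s) sums g s)"
  have "connected (- {1::complex})"
    using connected_open_delete[of UNIV "1::complex"] convex_connected[OF convex_UNIV]
    by (simp add: Compl_eq_Diff_UNIV)
  moreover have "complex_of_real 2 \<in> {s. 1 < Re s}" by simp
  hence "{s. 1 < Re s} \<noteq> {}" by blast
  moreover have "g z = f z" if "z \<in> {s. 1 < Re s}" for z
    using that f(3)[of z] g by (intro sums_unique2[of _ "g z" "f z"]) auto
  moreover have "{s. 1 < Re s} \<subseteq> - {1}" by auto
  ultimately have "g z = f z" if "z \<in> - {1}" for z
    using analytic_continuation_open[of "{s. 1 < Re s}" "- {1}" g f z] that f g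
    by (simp add: open_halfspace_Re_gt open_Compl)
  thus "g = f" using g f(2) by (intro ext) (metis ComplI singletonD)
qed

lemma zeta_eq_glued: "zeta = zeta_glued"
proof (rule zeta_eqI[OF zeta_glued_holomorphic])
  fix s :: complex assume "Re s > 1"
  thus "(\<lambda>n. 1 / of_nat (Suc n) powr s) sums zeta_glued s"
    using zeta_right_sums[of s] by (auto simp: zeta_glued_def)
qed (simp add: zeta_glued_def)

lemma zeta_holomorphic: "zeta holomorphic_on - {1}"
  by (simp add: zeta_eq_glued zeta_glued_holomorphic)

lemma zeta_sums: "Re s > 1 \<Longrightarrow> (\<lambda>n. 1 / of_nat (Suc n) powr s) sums zeta s"
  using zeta_right_sums[of s] by (auto simp: zeta_eq_glued zeta_glued_def)

text \<open>The reflection formula at 1 - s; its strip -1 < Re (1 - s) < 1 becomes 0 < Re s <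
  2.\<close>

lemma zeta_functional_equation:
  assumes s: "0 < Re s" "Re s < 2" "s \<noteq> 1"
  shows "zeta (1 - s) = 2 * (2 * of_real pi) powr (- s) * cos (of_real pi * s / 2) * Gamma s * zeta s"
proof -
  have "sin (of_real pi * (1 - s) / 2) = cos (of_real pi * s / 2)"
    using sin_cos_eq[of "of_real pi * (1 - s) / 2"] by (simp add: field_simps)
  thus ?thesis using zeta_right_reflection[of "1 - s"] s by (simp add: zeta_eq_glued zeta_glued_def)
qed

text \<open>The Dirichlet coefficients are real, so the conjugated function satisfies the same
  characterization as \<open>zeta\<close>.\<close>

lemma zeta_cnj: "zeta (cnj s) = cnj (zeta s)"
proof -
  have "zeta = cnj \<circ> zeta \<circ> cnj"
  proof (rule zeta_eqI)
    show "(cnj \<circ> zeta \<circ> cnj) holomorphic_on - {1}"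
      by (intro holomorphic_on_compose_cnj_cnj holomorphic_on_subset[OF zeta_holomorphic]) auto
    show "(cnj \<circ> zeta \<circ> cnj) 1 = 0" by (simp add: zeta_eq_glued zeta_glued_def)
    fix s :: complex assume "Re s > 1"
    hence "(\<lambda>n. cnj (1 / of_nat (Suc n) powr cnj s)) sums cnj (zeta (cnj s))"
      unfolding sums_cnj by (intro zeta_sums) simp
    moreover have "cnj (1 / of_nat (Suc n) powr cnj s) = 1 / of_nat (Suc n) powr s" for n
      using cnj_powr[of "of_nat (Suc n)" "cnj s"] by simp
    ultimately show "(\<lambda>n. 1 / of_nat (Suc n) powr s) sums (cnj \<circ> zeta \<circ> cnj) s" by simp
  qed
  from fun_cong[OF this, of "cnj s"] show ?thesis by simp
qed

subsection \<open>The critical line\<close>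

text \<open>Euler's formula with the phase pi / 4 taken out. The argument of the remaining bracket
  of the cosine is the source of the arctan in \<open>alpha\<close>.\<close>

lemma cos_half_critical:
  "cos (of_real pi * critical_point \<rho> / 2) =
     of_real (exp (- pi * \<rho> / 2) / 2) * cis (pi / 4) * (1 - \<i> * of_real (exp (pi * \<rho>)))"
  and sin_half_critical:
  "sin (of_real pi * critical_point \<rho> / 2) =
     of_real (exp (- pi * \<rho> / 2) / 2) * cis (pi / 4) * (of_real (exp (pi * \<rho>)) - \<i>)"
proof -
  define z where "z = of_real pi * critical_point \<rho> / 2"
  have a: "exp (\<i> * z) = cis (pi / 4) * of_real (exp (- pi * \<rho> / 2))"
    unfolding cis_conv_exp exp_of_real[symmetric] exp_add[symmetric]
    by (rule arg_cong[of _ _ exp]) (simp add: z_def critical_point_def field_simps)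
  have "exp (- (\<i> * z)) = cis (pi / 4) * cis (- (pi / 2)) * of_real (exp (- pi * \<rho> / 2)) * of_real (exp (pi * \<rho>))"
    unfolding cis_conv_exp exp_of_real[symmetric] exp_add[symmetric]
    by (rule arg_cong[of _ _ exp]) (simp add: z_def critical_point_def field_simps)
  also have "cis (- (pi / 2)) = - \<i>" by (simp add: complex_eq_iff)
  finally have b: "exp (- (\<i> * z)) = cis (pi / 4) * (- \<i>) * of_real (exp (- pi * \<rho> / 2)) * of_real (exp (pi * \<rho>))" .
  have "cos z = of_real (exp (- pi * \<rho> / 2) / 2) * cis (pi / 4) * (1 - \<i> * of_real (exp (pi * \<rho>)))"
    unfolding cos_exp_eq a b by (simp add: algebra_simps)
  thus "cos (of_real pi * critical_point \<rho> / 2) =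
     of_real (exp (- pi * \<rho> / 2) / 2) * cis (pi / 4) * (1 - \<i> * of_real (exp (pi * \<rho>)))"
    by (simp only: z_def)
  have "sin z = of_real (exp (- pi * \<rho> / 2) / 2) * cis (pi / 4) * (of_real (exp (pi * \<rho>)) - \<i>)"
    unfolding sin_exp_eq a b by (simp add: field_simps)
  thus "sin (of_real pi * critical_point \<rho> / 2) =
     of_real (exp (- pi * \<rho> / 2) / 2) * cis (pi / 4) * (of_real (exp (pi * \<rho>)) - \<i>)"
    by (simp only: z_def)
qed

lemma one_minus_i_polar:
  "1 - \<i> * of_real x = of_real (sqrt (1 + x\<^sup>2)) * cis (- arctan x)"
proof -
  have "sqrt (1 + x\<^sup>2) \<noteq> 0" by (simp add: add_nonneg_eq_0_iff)
  thus ?thesis by (simp add: complex_eq_iff cos_arctan sin_arctan)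
qed

lemma cos_half_critical_nonzero: "cos (of_real pi * critical_point \<rho> / 2) \<noteq> 0"
proof -
  have "1 - \<i> * of_real (exp (pi * \<rho>)) \<noteq> 0" by (simp add: complex_eq_iff)
  thus ?thesis by (simp add: cos_half_critical)
qed

text \<open>The common prefactor of sine and cosine cancels. This is the origin of the hyperbolic
  cosine in the equation for \<open>rho_s\<close>.\<close>

lemma Re_tan_critical:
  "Re (sin (of_real pi * critical_point \<rho> / 2) / cos (of_real pi * critical_point \<rho> / 2)) = 1 / cosh (pi * \<rho>)"
proof -
  define E where "E = exp (pi * \<rho>)"
  have E: "E > 0" by (simp add: E_def)
  have "sin (of_real pi * critical_point \<rho> / 2) / cos (of_real pi * critical_point \<rho> / 2) =
        (of_real E - \<i>) / (1 - \<i> * of_real E)"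
    unfolding sin_half_critical cos_half_critical E_def[symmetric] by simp
  also have "Re \<dots> = 2 * E / (1 + E\<^sup>2)"
    by (simp add: Re_divide power2_eq_square)
  also have "\<dots> = 1 / ((E + 1 / E) / 2)"
    using E by (simp add: field_simps power2_eq_square)
  also have "(E + 1 / E) / 2 = cosh (pi * \<rho>)"
    by (simp add: E_def cosh_field_def exp_minus inverse_eq_divide)
  finally show ?thesis .
qed

section \<open>The factor of the functional equation: phase and logarithmic derivative\<close>

definition zeta_factor :: "complex \<Rightarrow> complex" where
  "zeta_factor s = 2 * (2 * of_real pi) powr (- s) * cos (of_real pi * s / 2) * Gamma s"

text \<open>The phases of the power, the cosine and Gamma add up to -2 \<open>alpha\<close> modulo 2
  pi. The modulus \<open>r\<close> stays open here; it is found later from the functional equation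
  at a point where zeta does not vanish.\<close>

lemma zeta_factor_critical:
  "\<exists>r>0. zeta_factor (critical_point \<rho>) = of_real r * cis (- 2 * alpha \<rho>)"
proof -
  define s where "s = critical_point \<rho>"
  have sZ: "s \<notin> \<int>\<^sub>\<le>\<^sub>0" by (auto simp: s_def critical_point_def complex_eq_iff elim!: nonpos_Ints_cases)
  have G: "Gamma s = of_real (exp (Re (ln_Gamma s))) * cis (Im (ln_Gamma s))"
    using sZ by (simp add: Gamma_complex_altdef exp_eq_polar)
  have "complex_of_real (2 * pi) powr (- s) = exp (- s * of_real (ln (2 * pi)))"
    by (simp add: powr_def Ln_of_real del: of_real_mult)
  also have "\<dots> = of_real (exp (- ln (2 * pi) / 2)) * cis (- \<rho> * ln (2 * pi))"
    by (simp add: exp_eq_polar s_def critical_point_def)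
  finally have P: "(2 * of_real pi) powr (- s) = of_real (exp (- ln (2 * pi) / 2)) * cis (- \<rho> * ln (2 * pi))"
    by simp
  define E where "E = exp (pi * \<rho>)"
  define r where "r = 2 * exp (- ln (2 * pi) / 2) * (exp (- pi * \<rho> / 2) / 2) * sqrt (1 + E\<^sup>2) * exp (Re (ln_Gamma s))"
  have "sqrt (1 + E\<^sup>2) > 0" by (intro real_sqrt_gt_zero add_pos_nonneg) auto
  hence r: "r > 0" by (simp add: r_def)
  have C: "cos (of_real pi * s / 2) = of_real (exp (- pi * \<rho> / 2) / 2) * cis (pi / 4) * (of_real (sqrt (1 + E\<^sup>2)) * cis (- arctan E))"
    unfolding s_def cos_half_critical E_def one_minus_i_polar ..
  have "zeta_factor s = of_real r * (cis (- \<rho> * ln (2 * pi)) * cis (pi / 4) * cis (- arctan E) * cis (Im (ln_Gamma s)))"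
    unfolding zeta_factor_def P C G r_def of_real_mult of_real_numeral by (simp only: mult_ac)
  \<comment> \<open>The constant 9 pi / 8 in \<open>alpha\<close> contributes 9 pi / 4, a full turn
    more than the pi / 4 from the cosine.\<close>
  also have "cis (- \<rho> * ln (2 * pi)) * cis (pi / 4) * cis (- arctan E) * cis (Im (ln_Gamma s)) =
     cis (- 2 * alpha \<rho> - 2 * pi)"
    unfolding cis_mult
    by (rule arg_cong[of _ _ cis]) (simp add: alpha_def s_def E_def algebra_simps)
  also have "\<dots> = cis (- 2 * alpha \<rho>)"
    by (simp add: cis_divide[symmetric])
  finally show ?thesis using r by (auto simp: s_def)
qed

lemma zeta_factor_deriv:
  "(zeta_factor has_field_derivative zeta_factor (critical_point \<rho>) *
     (- of_real (ln (2 * pi)) - of_real (pi / 2) * (sin (of_real pi * critical_point \<rho> / 2) /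
        cos (of_real pi * critical_point \<rho> / 2)) + Digamma (critical_point \<rho>))) (at (critical_point \<rho>))"
proof -
  define s where "s = critical_point \<rho>"
  have sZ: "s \<notin> \<int>\<^sub>\<le>\<^sub>0" by (auto simp: s_def critical_point_def complex_eq_iff elim!: nonpos_Ints_cases)
  have c: "cos (of_real pi * s / 2) \<noteq> 0" by (simp only: s_def cos_half_critical_nonzero not_False_eq_True)
  have p: "2 * complex_of_real pi = of_real (2 * pi)" by simp
  have L: "Ln (complex_of_real (2 * pi)) = of_real (ln (2 * pi))" by (rule Ln_of_real) simp
  define a where "a = complex_of_real (2 * pi)"
  have a: "a \<noteq> 0" by (simp add: a_def)
  have P: "((\<lambda>w. a powr (- w)) has_field_derivative - Ln a * a powr (- s)) (at s)"
    using a by (auto simp: powr_def intro!: derivative_eq_intros)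
  have "(zeta_factor has_field_derivative
     2 * (- Ln a * a powr (- s)) * cos (of_real pi * s / 2) * Gamma s
     - 2 * a powr (- s) * (of_real pi / 2 * sin (of_real pi * s / 2)) * Gamma s
     + 2 * a powr (- s) * cos (of_real pi * s / 2) * (Gamma s * Digamma s)) (at s)"
    unfolding zeta_factor_def[abs_def] p a_def[symmetric] using sZ a
    by (auto intro!: derivative_eq_intros P simp: algebra_simps)
  also have "2 * (- Ln a * a powr (- s)) * cos (of_real pi * s / 2) * Gamma s
     - 2 * a powr (- s) * (of_real pi / 2 * sin (of_real pi * s / 2)) * Gamma s
     + 2 * a powr (- s) * cos (of_real pi * s / 2) * (Gamma s * Digamma s) =
    zeta_factor s * (- Ln a - of_real pi / 2 * (sin (of_real pi * s / 2) / cos (of_real pi * s / 2)) + Digamma s)"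
    unfolding zeta_factor_def p a_def[symmetric] using c by (simp add: field_simps)
  finally show ?thesis unfolding a_def L by (simp add: s_def)
qed

section \<open>Monotonicity of the digamma function on the critical line and uniqueness of
  \<open>rho_s\<close>\<close>

lemma Re_euler_mascheroni: "Re euler_mascheroni = euler_mascheroni"
  using Re_complex_of_real[of euler_mascheroni] by (simp only: of_real_euler_mascheroni)

text \<open>Termwise comparison of the digamma series: with b = n + 1/2 the subtracted real part b /
  (b^2 + t^2) decreases for t \<ge> 0.\<close>

lemma Re_Digamma_critical_mono:
  assumes "0 \<le> x" "x \<le> y"
  shows "Re (Digamma (critical_point x)) \<le> Re (Digamma (critical_point y))"
proof -
  have S: "(\<lambda>n. Re (inverse (of_nat (Suc n)) - inverse (critical_point t + of_nat n))) sums
      (Re (Digamma (critical_point t)) + euler_mascheroni)" for t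
  proof -
    have "critical_point t \<noteq> 0" by (simp add: critical_point_def complex_eq_iff)
    from sums_Re[OF summable_sums[OF summable_Digamma[OF this]]] show ?thesis
      by (simp add: Digamma_def Re_euler_mascheroni)
  qed
  have "Re (Digamma (critical_point x)) + euler_mascheroni \<le> Re (Digamma (critical_point y)) + euler_mascheroni"
  proof (rule sums_le[OF _ S S])
    fix n
    define b where "b = real n + 1 / 2"
    have b: "b > 0" by (simp add: b_def)
    have R: "Re (inverse (critical_point t + of_nat n)) = b / (b\<^sup>2 + t\<^sup>2)" for t
      by (simp add: critical_point_def b_def add.commute)
    have "b / (b\<^sup>2 + y\<^sup>2) \<le> b / (b\<^sup>2 + x\<^sup>2)"
      using assms b by (intro divide_left_mono add_left_mono power_mono mult_pos_pos add_pos_nonneg) auto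
    thus "Re (inverse (of_nat (Suc n)) - inverse (critical_point x + of_nat n))
        \<le> Re (inverse (of_nat (Suc n)) - inverse (critical_point y + of_nat n))"
      unfolding minus_complex.sel R by simp
  qed
  thus ?thesis by simp
qed

definition rho_s_function :: "real \<Rightarrow> real" where
  "rho_s_function \<rho> = 2 * ln (2 * pi) * cosh (pi * \<rho>)
       - 2 * Re (Digamma (critical_point \<rho>)) * cosh (pi * \<rho>) + pi"

text \<open>At a zero, 2 Re psi equals 2 ln (2 pi) + pi / cosh (pi t). The left side is
  nondecreasing and the right side strictly decreasing on t \<ge> 0.\<close>

lemma rho_s_function_zero_unique:
  assumes "0 \<le> x" "x < y" "rho_s_function x = 0" "rho_s_function y = 0"
  shows False
proof -
  have E: "2 * Re (Digamma (critical_point t)) = 2 * ln (2 * pi) + pi / cosh (pi * t)"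
    if "rho_s_function t = 0" for t
    using that cosh_real_pos[of "pi * t"] by (simp add: rho_s_function_def field_simps)
  have "cosh (pi * x) < cosh (pi * y)"
    using assms by (subst cosh_real_nonneg_less_iff) auto
  hence "pi / cosh (pi * y) < pi / cosh (pi * x)"
    using cosh_real_pos[of "pi * x"] by (intro divide_strict_left_mono) auto
  thus False using E[OF assms(3)] E[OF assms(4)] Re_Digamma_critical_mono[of x y] assms by simp
qed

text \<open>The given zero is itself the witness of existence that the definite description calls
  for. Since that description ranges over positive numbers, \<rho> = 0 must be excluded first, by
  the value of the digamma function at 1/2.\<close>

lemma rho_s_function_zero:
  assumes \<rho>: "\<rho> \<ge> 0" and z: "rho_s_function \<rho> = 0"
  shows "\<rho> = rho_s"
proof -
  have "rho_s_function 0 > 0"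
  proof -
    have "Re (Digamma (critical_point 0)) = - euler_mascheroni - 2 * ln 2"
      by (simp add: critical_point_def Digamma_one_half Re_euler_mascheroni)
    moreover have "ln (2 * pi) > 0" using pi_gt3 by (intro ln_gt_zero) auto
    moreover have "rho_s_function 0 = 2 * ln (2 * pi) - 2 * Re (Digamma (critical_point 0)) + pi"
      by (simp add: rho_s_function_def)
    moreover have "ln (2 :: real) > 0" by simp
    ultimately show ?thesis using euler_mascheroni_pos pi_gt_zero by linarith
  qed
  hence pos: "\<rho> > 0" using \<rho> z by (cases "\<rho> = 0") auto
  have "rho_s = \<rho>"
    unfolding rho_s_def rho_s_function_def[symmetric]
  proof (rule the_equality)
    fix t assume "t > 0 \<and> rho_s_function t = 0"
    thus "t = \<rho>" using rho_s_function_zero_unique[of t \<rho>] rho_s_function_zero_unique[of \<rho> t] z pos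
      by (cases t \<rho> rule: linorder_cases) auto
  qed (use pos z in auto)
  thus ?thesis ..
qed

section \<open>The derivative of zeta and the conclusion\<close>

lemma zeta_has_field_derivative:
  assumes "s \<noteq> 1"
  shows "(zeta has_field_derivative deriv zeta s) (at s)"
  using assms by (intro holomorphic_derivI[OF zeta_holomorphic]) auto

lemma deriv_zeta_cnj:
  assumes "s \<noteq> 1"
  shows "deriv zeta (cnj s) = cnj (deriv zeta s)"
proof (rule DERIV_imp_deriv)
  have "cnj \<circ> zeta \<circ> cnj = zeta" by (rule ext) (simp add: zeta_cnj)
  thus "(zeta has_field_derivative cnj (deriv zeta s)) (at (cnj s))"
    using has_field_derivative_cnj_cnj[of zeta "deriv zeta s" "cnj s"] zeta_has_field_derivative[OF assms] by simp
qed

theorem mainTheorem8: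
  fixes \<rho> :: real
  assumes "\<rho> \<ge> 0"
    and "\<rho> \<noteq> rho_s"
    and "deriv zeta (critical_point \<rho>) \<noteq> 0"
    and "cos (alpha \<rho>) \<noteq> 0"
    and "cos (beta \<rho>) \<noteq> 0"
    and "1 + tan (alpha \<rho>) * tan (beta \<rho>) = 0"
  shows "zeta (critical_point \<rho>) = 0"
proof (rule ccontr)
  define s where "s = critical_point \<rho>"
  define L where "L = - of_real (ln (2 * pi)) - of_real (pi / 2) * (sin (of_real pi * s / 2) /
        cos (of_real pi * s / 2)) + Digamma s"
  assume "zeta (critical_point \<rho>) \<noteq> 0"
  hence z: "zeta s \<noteq> 0" by (simp add: s_def)
  have s: "s \<noteq> 1" "1 - s = cnj s" "1 - s \<noteq> 1"
    by (auto simp: s_def critical_point_def complex_eq_iff)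
  \<comment> \<open>Differentiating the functional equation requires it on an open neighbourhood of
    \<open>s\<close>, not only on the critical line.\<close>
  define S where "S = {s. 0 < Re s} \<inter> {s. Re s < 2} - {1}"
  have oS: "open S" unfolding S_def
    by (intro open_Diff open_Int open_halfspace_Re_gt open_halfspace_Re_lt closed_singleton)
  have sS: "s \<in> S" using s by (simp add: S_def s_def critical_point_def)
  have FE: "zeta (1 - w) = zeta_factor w * zeta w" if "w \<in> S" for w
    using zeta_functional_equation[of w] that by (simp add: S_def zeta_factor_def)
  obtain r where r: "r > 0" "zeta_factor s = of_real r * cis (- 2 * alpha \<rho>)"
    using zeta_factor_critical[of \<rho>] by (auto simp: s_def)
  \<comment> \<open>Here 1 - s is the conjugate of s, so the factor maps the nonzero value zeta s to
    its conjugate and has modulus 1. Hence r = 1.\<close>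
  have K: "zeta_factor s = cis (- 2 * alpha \<rho>)"
  proof -
    have "cnj (zeta s) = zeta_factor s * zeta s"
      using FE[OF sS] by (simp add: s zeta_cnj)
    hence "norm (zeta_factor s) = 1"
      using z by (metis complex_mod_cnj mult_cancel_right1 norm_eq_zero norm_mult)
    thus ?thesis using r by (simp add: norm_mult)
  qed
  have "((\<lambda>w. 1 - w) has_field_derivative - 1) (at s)"
    by (auto intro!: derivative_eq_intros)
  from DERIV_chain2[where f = zeta and g = "\<lambda>w. 1 - w", OF zeta_has_field_derivative[OF s(3)] this]
  have "((\<lambda>w. zeta (1 - w)) has_field_derivative - deriv zeta (1 - s)) (at s)" by simp
  moreover have "((\<lambda>w. zeta_factor w * zeta w) has_field_derivative
      zeta_factor s * L * zeta s + deriv zeta s * zeta_factor s) (at s)"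
    unfolding L_def s_def
    by (rule DERIV_mult[OF zeta_factor_deriv zeta_has_field_derivative]) (use s in \<open>simp add: s_def\<close>)
  hence "((\<lambda>w. zeta (1 - w)) has_field_derivative
      zeta_factor s * L * zeta s + deriv zeta s * zeta_factor s) (at s)"
    by (rule has_field_derivative_transform_within_open[OF _ oS sS]) (simp add: FE)
  ultimately have D: "- cnj (deriv zeta s) = zeta_factor s * L * zeta s + deriv zeta s * zeta_factor s"
    unfolding s(2) deriv_zeta_cnj[OF s(1)] by (rule DERIV_unique)
  have cos0: "cos (beta \<rho> - alpha \<rho>) = 0"
  proof -
    have "cos (beta \<rho> - alpha \<rho>) = cos (alpha \<rho>) * cos (beta \<rho>) * (1 + tan (alpha \<rho>) * tan (beta \<rho>))"
      using assms(4,5) by (simp add: cos_diff tan_def field_simps)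
    thus ?thesis using assms(6) by simp
  qed
  have zb: "deriv zeta s = of_real (norm (deriv zeta s)) * cis (beta \<rho>)"
    using rcis_cmod_Arg[of "deriv zeta s"] by (simp add: rcis_def beta_def s_def)
  \<comment> \<open>Multiplying by \<open>cis (alpha \<rho>)\<close> symmetrizes the two terms into
    conjugates of each other, whose sum is 2 |zeta' s| cos (beta - alpha) = 0.\<close>
  have "cis (alpha \<rho>) * (cnj (deriv zeta s) + deriv zeta s * zeta_factor s) =
      of_real (norm (deriv zeta s)) * (cis (- (beta \<rho> - alpha \<rho>)) + cis (beta \<rho> - alpha \<rho>))"
  proof -
    define c where "c = complex_of_real (norm (deriv zeta s))"
    have "cis (alpha \<rho>) * cis (- beta \<rho>) = cis (- (beta \<rho> - alpha \<rho>))"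
      and "cis (alpha \<rho>) * (cis (beta \<rho>) * cis (- 2 * alpha \<rho>)) = cis (beta \<rho> - alpha \<rho>)"
      by (simp_all add: cis_mult)
    moreover have "deriv zeta s = c * cis (beta \<rho>)" "cnj (deriv zeta s) = c * cis (- beta \<rho>)"
      unfolding c_def by (rule zb, subst zb) (simp add: cis_cnj)
    ultimately show ?thesis
      unfolding K c_def[symmetric] by (simp only: distrib_left mult.left_commute mult.assoc)
  qed
  also have "cis (- (beta \<rho> - alpha \<rho>)) + cis (beta \<rho> - alpha \<rho>) = 0"
    unfolding cis_cnj[symmetric] using cos0 by (simp add: complex_eq_iff)
  finally have "cnj (deriv zeta s) = - (deriv zeta s * zeta_factor s)"
    by (simp add: eq_neg_iff_add_eq_0)
  hence "zeta_factor s * L * zeta s = 0" using D by simp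
  hence "L = 0" using z K by simp
  hence "Re L = 0" by simp
  \<comment> \<open>Multiplied by -2 cosh (pi \<rho>), this is
    \<open>rho_s_function \<rho>\<close>.\<close>
  moreover have "Re L = - ln (2 * pi) - pi / 2 * (1 / cosh (pi * \<rho>)) + Re (Digamma s)"
    unfolding L_def s_def plus_complex.sel minus_complex.sel Re_complex_of_real Re_tan_critical[symmetric]
      uminus_complex.sel times_complex.sel Im_complex_of_real by simp
  ultimately have "rho_s_function \<rho> = 0"
    unfolding rho_s_function_def s_def using cosh_real_pos[of "pi * \<rho>"] by (simp add: field_simps)
  thus False using rho_s_function_zero[OF assms(1)] assms(2) by blast
qed

end
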